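(* Let $\mathcal{A}$ be a generic arrangement of $r$ hyperplanes in $K^n$, with $n\ge3$, $m\ge1$ and $n+m-1<r$, and let $Q=\prod_{H\in\mathcal{A}}p_H$. Then the $S/SQ$-module $S^{\binom{n+m-1}{m-1}}/\bigl(J_m(\mathcal{A})+QS^{\binom{n+m-1}{m-1}}\bigr)$ is the transpose of the $m$-jet module $\Omega^{[1,m]}(S/SQ)$.
   Context: $K$ is a field of characteristic zero and $S=K[x_1,\ldots,x_n]$. Hyperplanes are linear; an arrangement is a finite set of distinct hyperplanes; it is generic if every $n$ of its hyperplanes intersect only at the origin; $p_H$ is a fixed linear form defining $H$. The Weyl algebra $S\langle\partial_1,\ldots,\partial_n\rangle$ acts on $S$ by $*$. Identify $S^{\binom{n+m-1}{m-1}}=\bigoplus_{|\beta|\le m-1}Se_\beta$ (with $\beta\in\mathbb{N}^n$). $J_m(\mathcal{A})$ is its $S$-submodule generated by all $\sum_{|\beta|\le m-1}\frac{1}{(\alpha-\beta)!}(\partial^{\alpha-\beta}*Q)e_\beta$ with $\alpha\in\mathbb{N}^n$, $1\le|\alpha|\le m$, where $\partial^{\alpha-\beta}=0$ if $\beta\not\le\alpha$. For $R=S/SQ$, let $J_R=\langle1\otimes a-a\otimes1\mid a\in R\rangle\subseteq R\otimes_KR$; the $m$-jet module is $\Omega^{[1,m]}(R)=J_R/J_R^{m+1}$, an $R$-module via the left factor $R\otimes1$. The transpose of a finitely presented $R$-module $M$ with presentation $P_1\xrightarrow{f}P_0\to M\to0$ by finitely generated free $R$-modules is $\operatorname{Coker}(f^*:\operatorname{Hom}_R(P_0,R)\to\operatorname{Hom}_R(P_1,R))$,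 i.e. the cokernel of the transposed presentation matrix (depending on the presentation only up to projective direct summands). *)

theory Defs
  imports
    "HOL-Algebra.Algebra"
    "HOL-Algebra.Algebraic_Closure_Type"
    "HOL-Analysis.Finite_Cartesian_Product"
begin

section \<open>Modules\<close>

text \<open>Modules are records of type \<open>module\<close>. Such a record also has fields \<open>mult\<close> and \<open>one\<close>; for
  algebras these are the ring structure, for mere modules they carry no meaning.\<close>

definition module_hom ::
  "('a, 'r) ring_scheme \<Rightarrow> ('a, 'b, 'p) module_scheme \<Rightarrow> ('a, 'c, 'q) module_scheme \<Rightarrow> ('b \<Rightarrow> 'c) set"
  where "module_hom R M N =
    {h \<in> hom (add_monoid M) (add_monoid N).
       \<forall>r\<in>carrier R. \<forall>x\<in>carrier M. h (r \<odot>\<^bsub>M\<^esub> x) = r \<odot>\<^bsub>N\<^esub> h x}"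

definition module_isomorphic ::
  "('a, 'r) ring_scheme \<Rightarrow> ('a, 'b, 'p) module_scheme \<Rightarrow> ('a, 'c, 'q) module_scheme \<Rightarrow> bool"
  where "module_isomorphic R M N \<longleftrightarrow>
    (\<exists>h\<in>module_hom R M N. bij_betw h (carrier M) (carrier N))"

definition generated_submodule ::
  "('a, 'b) ring_scheme \<Rightarrow> ('a, 'c) module \<Rightarrow> 'c set \<Rightarrow> 'c set"
  where "generated_submodule R M G = \<Inter>{N. submodule N R M \<and> G \<subseteq> N}"

text \<open>The library's \<open>FactRing\<close> with scalar multiplication added. It serves both for the quotient of
  a module by a submodule and for the quotient of an algebra by an ideal.\<close>

definition quot_module :: "('a, 'b, 'm) module_scheme \<Rightarrow> 'b set \<Rightarrow> ('a, 'b set) module"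
  where "quot_module M N =
    \<lparr>carrier = a_rcosets\<^bsub>M\<^esub> N, monoid.mult = rcoset_mult M N, one = N +>\<^bsub>M\<^esub> \<one>\<^bsub>M\<^esub>, ring.zero = N,
     add = set_add M, module.smult = (\<lambda>r C. \<Union>x\<in>C. N +>\<^bsub>M\<^esub> (r \<odot>\<^bsub>M\<^esub> x))\<rparr>"

text \<open>A module over \<open>S\<close> killed by an ideal \<open>I\<close>, regarded as a module over \<open>S Quot I\<close>: the class
  \<open>C\<close> acts as any of its representatives (they all act in the same way).\<close>

definition module_over_quotient :: "('a, 'b, 'm) module_scheme \<Rightarrow> ('a set, 'b) module"
  where "module_over_quotient M =
    \<lparr>carrier = carrier M, monoid.mult = monoid.mult M, one = one M, ring.zero = ring.zero M, add = add M,
     module.smult = (\<lambda>C v. the_elem ((\<lambda>a. a \<odot>\<^bsub>M\<^esub> v) ` C))\<rparr>"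

text \<open>\<open>R\<^sup>I\<close>, used for finite \<open>I\<close> only, where it is the free module \<open>\<Oplus>\<^sub>i R e\<^sub>i\<close> (the tuple \<open>f\<close> being
  \<open>\<Sum>\<^sub>i f i e\<^sub>i\<close>).\<close>

definition free_module :: "('a, 'm) ring_scheme \<Rightarrow> 'i set \<Rightarrow> ('a, 'i \<Rightarrow> 'a) module"
  where "free_module R I =
    \<lparr>carrier = I \<rightarrow>\<^sub>E carrier R,
     monoid.mult = (\<lambda>f g. \<lambda>i\<in>I. f i \<otimes>\<^bsub>R\<^esub> g i), one = (\<lambda>i\<in>I. \<one>\<^bsub>R\<^esub>),
     ring.zero = (\<lambda>i\<in>I. \<zero>\<^bsub>R\<^esub>), add = (\<lambda>f g. \<lambda>i\<in>I. f i \<oplus>\<^bsub>R\<^esub> g i),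
     module.smult = (\<lambda>r f. \<lambda>i\<in>I. r \<otimes>\<^bsub>R\<^esub> f i)\<rparr>"

definition regular_module :: "('a, 'm) ring_scheme \<Rightarrow> ('a, 'a) module"
  where "regular_module R =
    \<lparr>carrier = carrier R, monoid.mult = monoid.mult R, one = one R, ring.zero = ring.zero R, add = add R, module.smult = monoid.mult R\<rparr>"

text \<open>\<open>Hom\<^sub>R(M, R)\<close>; homomorphisms are made extensional so that they are determined by their values
  on \<open>M\<close>.\<close>

definition dual_module :: "('a, 'r) ring_scheme \<Rightarrow> ('a, 'b, 'm) module_scheme \<Rightarrow> ('a, 'b \<Rightarrow> 'a) module"
  where "dual_module R M =
    \<lparr>carrier = module_hom R M (regular_module R) \<inter> extensional (carrier M),
     monoid.mult = (\<lambda>f g. \<lambda>x\<in>carrier M. f x \<otimes>\<^bsub>R\<^esub> g x), one = (\<lambda>x\<in>carrier M. \<one>\<^bsub>R\<^esub>),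
     ring.zero = (\<lambda>x\<in>carrier M. \<zero>\<^bsub>R\<^esub>), add = (\<lambda>f g. \<lambda>x\<in>carrier M. f x \<oplus>\<^bsub>R\<^esub> g x),
     module.smult = (\<lambda>r f. \<lambda>x\<in>carrier M. r \<otimes>\<^bsub>R\<^esub> f x)\<rparr>"

definition dual_map ::
  "('a, 'b, 'p) module_scheme \<Rightarrow> ('b \<Rightarrow> 'c) \<Rightarrow> ('c \<Rightarrow> 'a) \<Rightarrow> 'b \<Rightarrow> 'a"
  where "dual_map P f \<phi> = (\<lambda>x\<in>carrier P. \<phi> (f x))"

text \<open>\<open>is_transpose R M N\<close>: for some exact sequence \<open>P1 \<rightarrow> P0 \<rightarrow> M \<rightarrow> 0\<close> with finitely generated
  free \<open>P1 = R\<^sup>q\<close> and \<open>P0 = R\<^sup>p\<close> and maps \<open>f\<close>, \<open>g\<close>, the module \<open>N\<close> is isomorphic to the cokernel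
  of \<open>f\<^sup>* : Hom\<^sub>R(P0, R) \<rightarrow> Hom\<^sub>R(P1, R)\<close>. The presentation is existentially quantified since the
  cokernel is determined by \<open>M\<close> only up to projective direct summands.\<close>

definition is_transpose ::
  "('a, 'r) ring_scheme \<Rightarrow> ('a, 'b, 'p) module_scheme \<Rightarrow> ('a, 'c, 'q) module_scheme \<Rightarrow> bool"
  where "is_transpose R M N \<longleftrightarrow> module R M \<and> module R N \<and>
    (\<exists>(p::nat) (q::nat) f g.
       let P0 = free_module R {..<p}; P1 = free_module R {..<q} in
         f \<in> module_hom R P1 P0 \<and> g \<in> module_hom R P0 M \<and>
         g ` carrier P0 = carrier M \<and> a_kernel P0 M g = f ` carrier P1 \<and>
         module_isomorphic R N
           (quot_module (dual_module R P1) (dual_map P1 f ` carrier (dual_module R P0))))"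


section \<open>Tensor product of algebras and jet modules\<close>

text \<open>The tensor product of the algebras \<open>A\<close> and \<open>B\<close> over \<open>K\<close> is the free abelian group on
  \<open>A \<times> B\<close> modulo the subgroup generated by the usual relations, with the product induced by the
  biadditive extension of \<open>(a, b) (a', b') = (a a', b b')\<close>.\<close>

definition pair_ring :: "('a, 'm) ring_scheme \<Rightarrow> ('b, 'n) ring_scheme \<Rightarrow> ('a \<times> 'b \<Rightarrow>\<^sub>0 int) ring"
  where "pair_ring A B =
    \<lparr>carrier = carrier (free_Abelian_group (carrier A \<times> carrier B)),
     monoid.mult = (\<lambda>x y. frag_extend (\<lambda>(a, b). frag_extend
               (\<lambda>(a', b'). frag_of (a \<otimes>\<^bsub>A\<^esub> a', b \<otimes>\<^bsub>B\<^esub> b')) y) x),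
     one = frag_of (\<one>\<^bsub>A\<^esub>, \<one>\<^bsub>B\<^esub>), ring.zero = 0, add = (+)\<rparr>"

definition tensor_relations ::
  "('k, 'r) ring_scheme \<Rightarrow> ('k, 'a, 'm) module_scheme \<Rightarrow> ('k, 'b, 'n) module_scheme
     \<Rightarrow> ('a \<times> 'b \<Rightarrow>\<^sub>0 int) set"
  where "tensor_relations K A B =
    {frag_of (a \<oplus>\<^bsub>A\<^esub> a', b) - frag_of (a, b) - frag_of (a', b) | a a' b.
       a \<in> carrier A \<and> a' \<in> carrier A \<and> b \<in> carrier B} \<union>
    {frag_of (a, b \<oplus>\<^bsub>B\<^esub> b') - frag_of (a, b) - frag_of (a, b') | a b b'.
       a \<in> carrier A \<and> b \<in> carrier B \<and> b' \<in> carrier B} \<union>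
    {frag_of (c \<odot>\<^bsub>A\<^esub> a, b) - frag_of (a, c \<odot>\<^bsub>B\<^esub> b) | c a b.
       c \<in> carrier K \<and> a \<in> carrier A \<and> b \<in> carrier B}"

definition tensor_kernel ::
  "('k, 'r) ring_scheme \<Rightarrow> ('k, 'a, 'm) module_scheme \<Rightarrow> ('k, 'b, 'n) module_scheme
     \<Rightarrow> ('a \<times> 'b \<Rightarrow>\<^sub>0 int) set"
  where "tensor_kernel K A B =
    generate (free_Abelian_group (carrier A \<times> carrier B)) (tensor_relations K A B)"

definition tensor_ring ::
  "('k, 'r) ring_scheme \<Rightarrow> ('k, 'a, 'm) module_scheme \<Rightarrow> ('k, 'b, 'n) module_scheme
     \<Rightarrow> ('a \<times> 'b \<Rightarrow>\<^sub>0 int) set ring"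
  where "tensor_ring K A B = pair_ring A B Quot tensor_kernel K A B"

definition tensor ::
  "('k, 'r) ring_scheme \<Rightarrow> ('k, 'a, 'm) module_scheme \<Rightarrow> ('k, 'b, 'n) module_scheme
     \<Rightarrow> 'a \<Rightarrow> 'b \<Rightarrow> ('a \<times> 'b \<Rightarrow>\<^sub>0 int) set"
  where "tensor K A B a b = tensor_kernel K A B +>\<^bsub>pair_ring A B\<^esub> frag_of (a, b)"

definition diagonal_ideal ::
  "('k, 'r) ring_scheme \<Rightarrow> ('k, 'a, 'm) module_scheme \<Rightarrow> ('a \<times> 'a \<Rightarrow>\<^sub>0 int) set set"
  where "diagonal_ideal K R =
    Idl\<^bsub>tensor_ring K R R\<^esub>
      {tensor K R R \<one>\<^bsub>R\<^esub> a \<ominus>\<^bsub>tensor_ring K R R\<^esub> tensor K R R a \<one>\<^bsub>R\<^esub> | a. a \<in> carrier R}"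

text \<open>\<open>J\<^sub>R / J\<^sub>R\<^sup>m\<^sup>+\<^sup>1\<close>, where \<open>R\<close> acts through the left tensor factor. The power is taken in the
  library's semiring \<open>ideals_set\<close> of ideals.\<close>

definition jet_module ::
  "('k, 'r) ring_scheme \<Rightarrow> ('k, 'a, 'm) module_scheme \<Rightarrow> nat
     \<Rightarrow> ('a, ('a \<times> 'a \<Rightarrow>\<^sub>0 int) set set) module"
  where "jet_module K R m =
    (let T = tensor_ring K R R; J = diagonal_ideal K R in
     quot_module
       \<lparr>carrier = J, monoid.mult = monoid.mult T, one = one T, ring.zero = ring.zero T, add = add T,
        module.smult = (\<lambda>r x. tensor K R R r \<one>\<^bsub>R\<^esub> \<otimes>\<^bsub>T\<^esub> x)\<rparr>
       (J [^]\<^bsub>ideals_set T\<^esub> (m + 1)))"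


section \<open>Polynomials\<close>

text \<open>The variables are indexed by a finite type \<open>'n\<close>, so that \<open>n = CARD('n)\<close> and multi-indices
  have type \<open>'n \<Rightarrow>\<^sub>0 nat\<close>.\<close>

type_synonym ('n, 'k) mpoly = "('n \<Rightarrow>\<^sub>0 nat) \<Rightarrow>\<^sub>0 'k"

definition mscale :: "'k::comm_ring_1 \<Rightarrow> ('n, 'k) mpoly \<Rightarrow> ('n, 'k) mpoly"
  where "mscale c f = Poly_Mapping.single 0 c * f"

definition poly_algebra :: "('k::comm_ring_1, ('n, 'k) mpoly) module"
  where "poly_algebra =
    \<lparr>carrier = UNIV, monoid.mult = (*), one = 1, ring.zero = 0, add = (+), module.smult = mscale\<rparr>"

definition partial :: "'n \<Rightarrow> ('n, 'k::comm_ring_1) mpoly \<Rightarrow> ('n, 'k) mpoly"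
  where "partial i f =
    (\<Sum>\<mu>\<in>Poly_Mapping.keys f. Poly_Mapping.single (\<mu> - Poly_Mapping.single i 1)
       (of_nat (Poly_Mapping.lookup \<mu> i) * Poly_Mapping.lookup f \<mu>))"

text \<open>The action of \<open>\<partial>\<^sup>\<alpha>\<close>. As the partial derivatives commute, the order in which \<open>fold\<close> runs
  through the variables does not matter.\<close>

definition partials :: "('n::finite \<Rightarrow>\<^sub>0 nat) \<Rightarrow> ('n, 'k::comm_ring_1) mpoly \<Rightarrow> ('n, 'k) mpoly"
  where "partials \<alpha> f =
    Finite_Set.fold (\<lambda>i. partial i ^^ Poly_Mapping.lookup \<alpha> i) f UNIV"

definition msize :: "('n::finite \<Rightarrow>\<^sub>0 nat) \<Rightarrow> nat"
  where "msize \<alpha> = (\<Sum>i\<in>UNIV. Poly_Mapping.lookup \<alpha> i)"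

definition mfact :: "('n::finite \<Rightarrow>\<^sub>0 nat) \<Rightarrow> nat"
  where "mfact \<alpha> = (\<Prod>i\<in>UNIV. fact (Poly_Mapping.lookup \<alpha> i))"

text \<open>The library's order on \<open>\<Rightarrow>\<^sub>0\<close> is lexicographic, hence this one.\<close>

definition mle :: "('n \<Rightarrow>\<^sub>0 nat) \<Rightarrow> ('n \<Rightarrow>\<^sub>0 nat) \<Rightarrow> bool"
  where "mle \<beta> \<alpha> \<longleftrightarrow> (\<forall>i. Poly_Mapping.lookup \<beta> i \<le> Poly_Mapping.lookup \<alpha> i)"


section \<open>Arrangements\<close>

definition hyperplane_of :: "'k::comm_ring_1 ^ 'n \<Rightarrow> ('k ^ 'n) set"
  where "hyperplane_of a = {v. (\<Sum>i\<in>UNIV. a $ i * v $ i) = 0}"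

definition linear_form :: "'k::comm_ring_1 ^ 'n \<Rightarrow> ('n, 'k) mpoly"
  where "linear_form a = (\<Sum>i\<in>UNIV. Poly_Mapping.single (Poly_Mapping.single i 1) (a $ i))"

definition is_arrangement :: "('k::field ^ 'n) set set \<Rightarrow> bool"
  where "is_arrangement \<A> \<longleftrightarrow> finite \<A> \<and> (\<forall>H\<in>\<A>. \<exists>a. a \<noteq> 0 \<and> H = hyperplane_of a)"

definition generic_arrangement :: "('k::field ^ 'n) set set \<Rightarrow> bool"
  where "generic_arrangement \<A> \<longleftrightarrow> is_arrangement \<A> \<and>
    (\<forall>\<B>\<subseteq>\<A>. card \<B> = CARD('n) \<longrightarrow> \<Inter>\<B> = {0})"

definition defining_form :: "('n, 'k::field) mpoly \<Rightarrow> ('k ^ 'n) set \<Rightarrow> bool"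
  where "defining_form f H \<longleftrightarrow> (\<exists>a. a \<noteq> 0 \<and> f = linear_form a \<and> H = hyperplane_of a)"


section \<open>The module \<open>J\<^sub>m\<close>\<close>

text \<open>The index set of the standard basis of \<open>\<Oplus> S e\<^sub>\<beta>\<close>, where \<open>|\<beta>| \<le> m - 1\<close>; truncated subtraction
  is harmless, as \<open>m \<ge> 1\<close> throughout.\<close>

definition jet_indices :: "nat \<Rightarrow> ('n::finite \<Rightarrow>\<^sub>0 nat) set"
  where "jet_indices m = {\<beta>. msize \<beta> \<le> m - 1}"

definition jet_generator ::
  "nat \<Rightarrow> ('n::finite, 'k::field_char_0) mpoly \<Rightarrow> ('n \<Rightarrow>\<^sub>0 nat) \<Rightarrow> ('n \<Rightarrow>\<^sub>0 nat) \<Rightarrow> ('n, 'k) mpoly"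
  where "jet_generator m Q \<alpha> =
    (\<lambda>\<beta>\<in>jet_indices m.
       if mle \<beta> \<alpha> then mscale (1 / of_nat (mfact (\<alpha> - \<beta>))) (partials (\<alpha> - \<beta>) Q) else 0)"

definition jet_submodule ::
  "nat \<Rightarrow> ('n::finite, 'k::field_char_0) mpoly \<Rightarrow> (('n \<Rightarrow>\<^sub>0 nat) \<Rightarrow> ('n, 'k) mpoly) set"
  where "jet_submodule m Q =
    generated_submodule poly_algebra (free_module poly_algebra (jet_indices m))
      {jet_generator m Q \<alpha> | \<alpha>. 1 \<le> msize \<alpha> \<and> msize \<alpha> \<le> m}"

definition hypersurface_algebra ::
  "('n, 'k::comm_ring_1) mpoly \<Rightarrow> ('k, ('n, 'k) mpoly set) module"
  where "hypersurface_algebra Q = quot_module poly_algebra (PIdl\<^bsub>poly_algebra\<^esub> Q)"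

definition jet_quotient ::
  "nat \<Rightarrow> ('n::finite, 'k::field_char_0) mpoly
     \<Rightarrow> (('n, 'k) mpoly set, (('n \<Rightarrow>\<^sub>0 nat) \<Rightarrow> ('n, 'k) mpoly) set) module"
  where "jet_quotient m Q =
    (let F = free_module poly_algebra (jet_indices m) in
     module_over_quotient
       (quot_module F (jet_submodule m Q <+>\<^bsub>F\<^esub> {Q \<odot>\<^bsub>F\<^esub> v | v. v \<in> carrier F})))"

end

theory Submission
  imports Defs
begin

text \<open>Write \<open>R = S/SQ\<close> and let \<open>d\<^sub>i = 1 \<otimes> x\<^sub>i - x\<^sub>i \<otimes> 1\<close>, so that \<open>R \<otimes> R\<close> is generated as an
  algebra over the left factor by the \<open>d\<^sub>i\<close>. Since \<open>1 \<otimes> f(x) = f(x + d)\<close>, the only relation over \<open>R\<close> is \<open>Q(x + d) = 0\<close>: with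
  \<open>P = S[d\<^sub>1, \<dots>, d\<^sub>n]\<close>, the algebra \<open>R \<otimes> R\<close> is \<open>P\<close> modulo \<open>Q(x)\<close> and \<open>Q(x + d)\<close>, and \<open>J\<^sub>R\<close> corresponds to
  \<open>(d)\<close>. Hence \<open>J\<^sub>R / J\<^sub>R\<^sup>m\<^sup>+\<^sup>1\<close> is the free \<open>R\<close>-module on the monomials \<open>d\<^sup>\<alpha>\<close>, \<open>1 \<le> |\<alpha>| \<le> m\<close>, modulo
  the multiples \<open>d\<^sup>\<beta> Q(x + d)\<close>, and only \<open>|\<beta>| \<le> m - 1\<close> matters. By Taylor's formula the coefficient of
  \<open>d\<^sup>\<alpha>\<close> in \<open>d\<^sup>\<beta> Q(x + d)\<close> is \<open>\<partial>\<^sup>\<alpha>\<^sup>-\<^sup>\<beta> Q / (\<alpha> - \<beta>)!\<close>. Transposing this presentation matrix turns its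
  rows, indexed by \<open>\<alpha>\<close>, into the relations of the cokernel; modulo \<open>Q\<close> they are the generators of \<open>J\<^sub>m\<close>.

  Rings and modules are handled as images of polynomials. A surjection from a polynomial ring,
  which is a type of class \<open>comm_ring_1\<close>, onto the carrier of a record carries all structure, and a
  homomorphism of modules is determined by what happens to polynomials
  (\<open>module_presentation\<close>). For a module with generators indexed by \<open>\<alpha>\<close> and relations indexed by
  \<open>\<beta>\<close>, being the transpose then becomes a statement on coefficients modulo \<open>Q\<close>: see \<open>is_transposeI\<close>.
  The two modules of the theorem are brought into this form by \<open>jet_module_presentation\<close> with
  \<open>jet_relation_iff\<close>, and by \<open>jet_quotient_presentation\<close>.

  The remaining work is to identify the tensor product. A map \<open>to_jet\<close> from formal sums of pairs to \<open>P\<close>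
  sends \<open>a \<otimes> b\<close> to \<open>a(x) b(x + d)\<close>. It respects the tensor relations modulo \<open>Q(x)\<close> and
  \<open>Q(x + d)\<close>; conversely a formal sum with image in this ideal is a consequence of the
  tensor relations, because in the coordinates \<open>x\<close>, \<open>y = x + d\<close> each tensor has the
  normal form \<open>\<Sum>\<^sub>\<mu> s\<^sub>\<mu> \<otimes> y\<^sup>\<mu>\<close>, and the two relations of \<open>P\<close> have normal forms that vanish.\<close>


section \<open>Rings and modules as images of polynomials\<close>

abbreviation coef :: "('a \<Rightarrow>\<^sub>0 'b::zero) \<Rightarrow> 'a \<Rightarrow> 'b"
  where "coef \<equiv> Poly_Mapping.lookup"

text \<open>A ring given as an image of a type of class \<open>comm_ring_1\<close>. As the whole carrier is reached, the ring
  axioms follow from those of the type, and elements can be replaced by representatives.\<close>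

definition ring_presentation :: "('s::comm_ring_1 \<Rightarrow> 'r) \<Rightarrow> ('r, 'x) ring_scheme \<Rightarrow> bool"
  where "ring_presentation h R \<longleftrightarrow> carrier R = range h \<and> \<one>\<^bsub>R\<^esub> = h 1 \<and> \<zero>\<^bsub>R\<^esub> = h 0 \<and>
    (\<forall>a b. h (a + b) = h a \<oplus>\<^bsub>R\<^esub> h b \<and> h (a * b) = h a \<otimes>\<^bsub>R\<^esub> h b)"

lemma ring_presentationD:
  assumes "ring_presentation h R"
  shows "carrier R = range h" "\<one>\<^bsub>R\<^esub> = h 1" "\<zero>\<^bsub>R\<^esub> = h 0"
    "h a \<oplus>\<^bsub>R\<^esub> h b = h (a + b)" "h a \<otimes>\<^bsub>R\<^esub> h b = h (a * b)" "h a \<in> carrier R"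
  using assms by (auto simp: ring_presentation_def)

lemma ring_presentation_cring:
  assumes "ring_presentation h R"
  shows "cring R"
proof -
  note D = ring_presentationD[OF assms]
  show ?thesis
  proof (rule cringI)
    show "abelian_group R"
    proof (rule abelian_groupI)
      fix x assume "x \<in> carrier R"
      then obtain a where a: "x = h a" using D(1) by auto
      have "h (- a) \<in> carrier R" "h (- a) \<oplus>\<^bsub>R\<^esub> x = \<zero>\<^bsub>R\<^esub>"
        using D by (simp_all add: a)
      then show "\<exists>y\<in>carrier R. y \<oplus>\<^bsub>R\<^esub> x = \<zero>\<^bsub>R\<^esub>" by blast
    qed (auto simp: D algebra_simps)
    show "Group.comm_monoid R"
      by (rule Group.comm_monoidI) (auto simp: D algebra_simps)
  qed (auto simp: D algebra_simps)
qed

lemma ring_presentation_minus: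
  assumes "ring_presentation h R"
  shows "h a \<ominus>\<^bsub>R\<^esub> h b = h (a - b)"
proof -
  note D = ring_presentationD[OF assms]
  interpret cring R using ring_presentation_cring[OF assms] .
  have "h (a - b) \<oplus>\<^bsub>R\<^esub> h b = h a" by (simp add: D)
  then have "h (a - b) = h a \<ominus>\<^bsub>R\<^esub> h b"
    using D(6) by (metis add.inv_solve_right minus_eq)
  then show ?thesis by simp
qed

lemma coef_mscale [simp]: "coef (mscale s f) \<alpha> = s * coef f \<alpha>"
  by (simp add: mscale_def mult_map_scale_conv_mult[symmetric] Poly_Mapping.map.rep_eq when_def)

lemma mscale_simps [simp]:
  "mscale s (f + g) = mscale s f + mscale s g"
  "mscale (s + t) f = mscale s f + mscale t f"
  "mscale (s * t) f = mscale s (mscale t f)"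
  "mscale 1 f = f" "mscale 0 f = 0" "mscale s 0 = 0"
  "mscale s (f - g) = mscale s f - mscale s g"
  by (rule poly_mapping_eqI; simp add: lookup_add lookup_minus algebra_simps)+

lemma mscale_minus_one: "mscale (- 1) f = - f"
  by (rule poly_mapping_eqI) simp

text \<open>The module analogue: \<open>h\<close> maps the submodule \<open>D\<close> of a polynomial ring over \<open>'s\<close> onto \<open>M\<close> and is
  linear along the ring presentation \<open>\<pi>\<close>. A polynomial serves here as a finitely supported family
  of coefficients, so the same polynomial ring covers free modules, their duals and all their
  quotients. A proper \<open>D\<close> occurs for ideals, such as the polynomials without constant term.\<close>

definition module_presentation ::
  "('s::comm_ring_1 \<Rightarrow> 'r) \<Rightarrow> ('r, 'x) ring_scheme \<Rightarrow> (('n, 's) mpoly \<Rightarrow> 'b) \<Rightarrow> ('n, 's) mpoly set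
     \<Rightarrow> ('r, 'b, 'y) module_scheme \<Rightarrow> bool"
  where "module_presentation \<pi> R h D M \<longleftrightarrow> ring_presentation \<pi> R \<and>
    0 \<in> D \<and> (\<forall>f\<in>D. \<forall>g\<in>D. f + g \<in> D) \<and> (\<forall>s. \<forall>f\<in>D. mscale s f \<in> D) \<and>
    carrier M = h ` D \<and> \<zero>\<^bsub>M\<^esub> = h 0 \<and> (\<forall>f\<in>D. \<forall>g\<in>D. h (f + g) = h f \<oplus>\<^bsub>M\<^esub> h g) \<and>
    (\<forall>s. \<forall>f\<in>D. h (mscale s f) = \<pi> s \<odot>\<^bsub>M\<^esub> h f)"

lemma module_presentationD:
  assumes "module_presentation \<pi> R h D M"
  shows "ring_presentation \<pi> R" "0 \<in> D" "f \<in> D \<Longrightarrow> g \<in> D \<Longrightarrow> f + g \<in> D" "f \<in> D \<Longrightarrow> mscale s f \<in> D"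
    "carrier M = h ` D" "\<zero>\<^bsub>M\<^esub> = h 0" "f \<in> D \<Longrightarrow> g \<in> D \<Longrightarrow> h f \<oplus>\<^bsub>M\<^esub> h g = h (f + g)"
    "f \<in> D \<Longrightarrow> \<pi> s \<odot>\<^bsub>M\<^esub> h f = h (mscale s f)"
    "f \<in> D \<Longrightarrow> - f \<in> D" "f \<in> D \<Longrightarrow> g \<in> D \<Longrightarrow> f - g \<in> D"
proof -
  show minus: "- f \<in> D" if "f \<in> D" for f
  proof -
    have "mscale (- 1) f \<in> D" using assms that unfolding module_presentation_def by blast
    then show ?thesis by (simp add: mscale_minus_one)
  qed
  show "f \<in> D \<Longrightarrow> g \<in> D \<Longrightarrow> f - g \<in> D"
    using assms minus[of g] unfolding module_presentation_def diff_conv_add_uminus[of f g] by blast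
qed (use assms in \<open>auto simp: module_presentation_def\<close>)

lemma module_presentation_module:
  assumes "module_presentation \<pi> R h D M"
  shows "module R M"
proof -
  note D = module_presentationD[OF assms]
  note DR = ring_presentationD[OF D(1)]
  show ?thesis
  proof (rule moduleI)
    show "cring R" using D(1) by (rule ring_presentation_cring)
    show "abelian_group M"
    proof (rule abelian_groupI)
      fix x assume "x \<in> carrier M"
      then obtain f where f: "f \<in> D" "x = h f" using D(5) by auto
      have "h (- f) \<in> carrier M" "h (- f) \<oplus>\<^bsub>M\<^esub> x = \<zero>\<^bsub>M\<^esub>"
        using D f by simp_all
      then show "\<exists>y\<in>carrier M. y \<oplus>\<^bsub>M\<^esub> x = \<zero>\<^bsub>M\<^esub>" by blast
    qed (auto simp: D algebra_simps)
  qed (auto simp: D DR)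
qed

lemma module_presentation_eq_iff:
  assumes "module_presentation \<pi> R h D M" and fg: "f \<in> D" "g \<in> D"
  shows "h f = h g \<longleftrightarrow> h (f - g) = \<zero>\<^bsub>M\<^esub>"
proof -
  note D = module_presentationD[OF assms(1)]
  interpret module R M using module_presentation_module[OF assms(1)] .
  have c: "h f \<in> carrier M" "h g \<in> carrier M" "h (f - g) \<in> carrier M" using D(5,10) fg by auto
  have "h (f - g) \<oplus>\<^bsub>M\<^esub> h g = h f" using D(7)[of "f - g" g] D(10) fg by simp
  moreover have "\<zero>\<^bsub>M\<^esub> \<oplus>\<^bsub>M\<^esub> h g = h g" using c by simp
  ultimately show ?thesis
    using M.add.right_cancel[OF c(2) c(3) M.zero_closed] by auto
qed

text \<open>Passing to a quotient module keeps the presenting polynomials and enlarges the kernel. Closure of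
  \<open>L\<close> under negation follows from closure under the action of \<open>- 1\<close>.\<close>

lemma quotient_presentation:
  assumes pres: "module_presentation \<pi> R h D M"
    and L: "L \<subseteq> carrier M" "\<zero>\<^bsub>M\<^esub> \<in> L" "\<And>x y. x \<in> L \<Longrightarrow> y \<in> L \<Longrightarrow> x \<oplus>\<^bsub>M\<^esub> y \<in> L"
      "\<And>s x. x \<in> L \<Longrightarrow> \<pi> s \<odot>\<^bsub>M\<^esub> x \<in> L"
  shows "module_presentation \<pi> R (\<lambda>f. L +>\<^bsub>M\<^esub> h f) D (quot_module M L)" (is ?pres)
    and "f \<in> D \<Longrightarrow> L +>\<^bsub>M\<^esub> h f = \<zero>\<^bsub>quot_module M L\<^esub> \<longleftrightarrow> h f \<in> L"
proof -
  note D = module_presentationD[OF pres]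
  interpret module R M using module_presentation_module[OF pres] .
  have inv: "\<ominus>\<^bsub>M\<^esub> x \<in> L" if x: "x \<in> L" for x
  proof -
    obtain f where f: "f \<in> D" "x = h f" using subsetD[OF L(1) x] by (auto simp: D(5))
    have "h (- f) \<oplus>\<^bsub>M\<^esub> x = \<zero>\<^bsub>M\<^esub>" using D f by simp
    then have "\<ominus>\<^bsub>M\<^esub> x = h (- f)"
      using D(5,9) f by (intro M.minus_equality) auto
    also have "\<dots> = \<pi> (- 1) \<odot>\<^bsub>M\<^esub> x" using D(8)[of f "- 1"] f by (simp add: mscale_minus_one)
    finally show ?thesis using L(4) that by simp
  qed
  have "additive_subgroup L M"
  proof
    show "L \<subseteq> carrier (add_monoid M)" using L(1) by simp
    show "inv\<^bsub>add_monoid M\<^esub> x \<in> L" if "x \<in> L" for x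
      using inv[OF that] by (simp add: a_inv_def)
  qed (use L in auto)
  then have "abelian_subgroup L M"
    using M.abelian_group_axioms by (rule abelian_subgroupI3)
  then interpret abelian_subgroup L M .
  have cl: "h f \<in> carrier M" if "f \<in> D" for f using that D(5) by auto
  have sm: "(\<Union>x\<in>L +>\<^bsub>M\<^esub> h f. L +>\<^bsub>M\<^esub> (\<pi> s \<odot>\<^bsub>M\<^esub> x)) = L +>\<^bsub>M\<^esub> h (mscale s f)" if f: "f \<in> D" for s f
  proof -
    have "L +>\<^bsub>M\<^esub> (\<pi> s \<odot>\<^bsub>M\<^esub> x) = L +>\<^bsub>M\<^esub> h (mscale s f)" if x: "x \<in> L +>\<^bsub>M\<^esub> h f" for x
    proof -
      obtain l where l: "l \<in> L" "x = l \<oplus>\<^bsub>M\<^esub> h f" using x by (auto simp: a_r_coset_def')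
      have "\<pi> s \<odot>\<^bsub>M\<^esub> x = (\<pi> s \<odot>\<^bsub>M\<^esub> l) \<oplus>\<^bsub>M\<^esub> h (mscale s f)"
        using l L(1) cl[OF f] D(8)[OF f] ring_presentationD(6)[OF D(1)]
        by (subst l(2), subst smult_r_distr) auto
      then have "\<pi> s \<odot>\<^bsub>M\<^esub> x \<in> L +>\<^bsub>M\<^esub> h (mscale s f)"
        using L(4) l(1) by (auto simp: a_r_coset_def')
      then show ?thesis
        using a_repr_independence[OF _ cl[OF D(4)[OF f]]] a_subgroup by simp
    qed
    moreover have "h f \<in> L +>\<^bsub>M\<^esub> h f" using a_rcos_self[OF cl[OF f]] .
    ultimately show ?thesis by blast
  qed
  show ?pres
    unfolding module_presentation_def
  proof (intro conjI ballI allI)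
    show "carrier (quot_module M L) = (\<lambda>f. L +>\<^bsub>M\<^esub> h f) ` D"
      by (auto simp: quot_module_def A_RCOSETS_def' D(5) a_r_coset_def')
    show "\<zero>\<^bsub>quot_module M L\<^esub> = L +>\<^bsub>M\<^esub> h 0"
      using a_coset_add_zero a_subset D(6) by (simp add: quot_module_def) 
    show "L +>\<^bsub>M\<^esub> h (f + g) = (L +>\<^bsub>M\<^esub> h f) \<oplus>\<^bsub>quot_module M L\<^esub> (L +>\<^bsub>M\<^esub> h g)"
      if "f \<in> D" "g \<in> D" for f g
      using a_rcos_sum[OF cl[OF that(1)] cl[OF that(2)]] D(7)[OF that] by (simp add: quot_module_def)
    show "L +>\<^bsub>M\<^esub> h (mscale s f) = \<pi> s \<odot>\<^bsub>quot_module M L\<^esub> (L +>\<^bsub>M\<^esub> h f)" if "f \<in> D" for s f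
      using sm[OF that] by (simp add: quot_module_def)
  qed (use D in auto)
  show "L +>\<^bsub>M\<^esub> h f = \<zero>\<^bsub>quot_module M L\<^esub> \<longleftrightarrow> h f \<in> L" if "f \<in> D"
  proof -
    have z: "\<zero>\<^bsub>quot_module M L\<^esub> = L" by (simp add: quot_module_def)
    have "L +>\<^bsub>M\<^esub> h f = L \<longleftrightarrow> h f \<in> L"
      using a_rcos_self[OF cl[OF that]] a_coset_join2[OF cl[OF that]] a_subgroup by auto
    then show ?thesis by (simp only: z)
  qed
qed

text \<open>Two quotients of the same module by the same kernel: choosing a preimage under \<open>h\<close> and applying
  \<open>h'\<close> does not depend on the choice.\<close>

lemma isomorphic_presentations:
  assumes "module_presentation \<pi> R h D M" "module_presentation \<pi> R h' D M'"
    and ker: "\<And>f. f \<in> D \<Longrightarrow> h f = \<zero>\<^bsub>M\<^esub> \<longleftrightarrow> h' f = \<zero>\<^bsub>M'\<^esub>"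
  shows "module_isomorphic R M M'"
proof -
  note D = module_presentationD[OF assms(1)]
  note D' = module_presentationD[OF assms(2)]
  define F where "F x = h' (inv_into D h x)" for x
  have F: "F (h f) = h' f" if "f \<in> D" for f
  proof -
    let ?g = "inv_into D h (h f)"
    have g: "?g \<in> D" "h ?g = h f" using that by (auto intro: inv_into_into f_inv_into_f)
    then show ?thesis
      using module_presentation_eq_iff[OF assms(1) g(1) that]
        module_presentation_eq_iff[OF assms(2) g(1) that] ker D(10)[OF g(1) that]
      by (simp add: F_def)
  qed
  have "F \<in> module_hom R M M'"
    using F D D' ring_presentationD[OF D(1)]
    by (auto simp: module_hom_def hom_def)
  moreover have "inj_on F (carrier M)"
  proof (rule inj_onI)
    fix x y assume "x \<in> carrier M" "y \<in> carrier M" and eq: "F x = F y"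
    then obtain f g where fg: "f \<in> D" "g \<in> D" "x = h f" "y = h g" using D(5) by auto
    then show "x = y"
      using eq F module_presentation_eq_iff[OF assms(1) fg(1,2)]
        module_presentation_eq_iff[OF assms(2) fg(1,2)] ker D(10)[OF fg(1,2)] by simp
  qed
  moreover have "F ` carrier M = carrier M'"
    using F by (force simp: D(5) D'(5))
  ultimately show ?thesis
    unfolding module_isomorphic_def bij_betw_def by blast
qed

text \<open>Coordinate \<open>i\<close> of the free module is read off from the coefficient at \<open>a i\<close>. Any \<open>D\<close> containing the
  monomials at these places is large enough to reach all tuples.\<close>

lemma free_module_presentation:
  assumes R: "ring_presentation \<pi> R"
    and I: "finite I" and a: "inj_on a I"
    and D: "0 \<in> D" "\<And>f g. f \<in> D \<Longrightarrow> g \<in> D \<Longrightarrow> f + g \<in> D" "\<And>s f. f \<in> D \<Longrightarrow> mscale s f \<in> D"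
      "\<And>i s. i \<in> I \<Longrightarrow> Poly_Mapping.single (a i) s \<in> D"
  shows "module_presentation \<pi> R (\<lambda>f. \<lambda>i\<in>I. \<pi> (coef f (a i))) D (free_module R I)"
proof -
  note R = R ring_presentationD[OF R]
  have sum_in: "(\<Sum>i\<in>J. Poly_Mapping.single (a i) (s i)) \<in> D" if "J \<subseteq> I" for J s
    using finite_subset[OF that I] that by (induction J) (auto intro: D)
  have "\<exists>f\<in>D. v = (\<lambda>i\<in>I. \<pi> (coef f (a i)))" if v: "v \<in> I \<rightarrow>\<^sub>E range \<pi>" for v
  proof
    define s where "s i = inv_into UNIV \<pi> (v i)" for i
    let ?f = "\<Sum>i\<in>I. Poly_Mapping.single (a i) (s i)"
    show "?f \<in> D" by (rule sum_in) simp
    show "v = (\<lambda>i\<in>I. \<pi> (coef ?f (a i)))"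
    proof
      fix i
      show "v i = (\<lambda>i\<in>I. \<pi> (coef ?f (a i))) i"
      proof (cases "i \<in> I")
        case True
        have "coef ?f (a i) = (\<Sum>j\<in>I. if j = i then s j else 0)"
          unfolding lookup_sum
          by (rule sum.cong) (use True a in \<open>auto simp: lookup_single when_def inj_on_def\<close>)
        also have "\<dots> = s i" using True I by simp
        finally show ?thesis
          using True v by (auto simp: s_def PiE_def Pi_def f_inv_into_f)
      qed (use v in auto)
    qed
  qed
  then show ?thesis
    unfolding module_presentation_def free_module_def
    by (auto simp: R D lookup_add PiE_def Pi_def image_iff intro!: ext) 
qed

lemma poly_mapping_sum_singles: "f = (\<Sum>k\<in>Poly_Mapping.keys f. Poly_Mapping.single k (coef f k))"
proof (rule poly_mapping_eqI)
  fix k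
  have "coef (\<Sum>k\<in>Poly_Mapping.keys f. Poly_Mapping.single k (coef f k)) k
      = (\<Sum>j\<in>Poly_Mapping.keys f. if j = k then coef f j else 0)"
    unfolding lookup_sum by (rule sum.cong) (auto simp: lookup_single when_def)
  then show "coef f k = coef (\<Sum>k\<in>Poly_Mapping.keys f. Poly_Mapping.single k (coef f k)) k"
    by (simp add: in_keys_iff)
qed

lemma poly_mapping_additive_induct [case_names single add]:
  assumes single: "\<And>k s. P (Poly_Mapping.single k s)"
    and add: "\<And>f g. P f \<Longrightarrow> P g \<Longrightarrow> P (f + g)"
  shows "P (f :: 'a \<Rightarrow>\<^sub>0 'b::comm_monoid_add)"
proof -
  have "P (\<Sum>k\<in>Y. Poly_Mapping.single k (coef f k))" if "finite Y" for Y
    using that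
  proof (induction Y)
    case empty
    have "P (Poly_Mapping.single k 0)" for k by (rule single)
    then show ?case by simp
  qed (simp add: single add)
  then show ?thesis using poly_mapping_sum_singles[of f] by (metis finite_keys)
qed

lemma coef_sum_singles:
  "finite Y \<Longrightarrow> coef (\<Sum>\<alpha>\<in>Y. Poly_Mapping.single \<alpha> (s \<alpha>)) \<beta> = (if \<beta> \<in> Y then s \<beta> else 0)"
proof -
  assume "finite Y"
  have "coef (\<Sum>\<alpha>\<in>Y. Poly_Mapping.single \<alpha> (s \<alpha>)) \<beta> = (\<Sum>\<alpha>\<in>Y. if \<alpha> = \<beta> then s \<alpha> else 0)"
    unfolding lookup_sum by (rule sum.cong) (auto simp: lookup_single when_def)
  then show ?thesis using \<open>finite Y\<close> by simp
qed

text \<open>The functional attached to \<open>f\<close> is the dot product with the coefficients of \<open>f\<close>. Its values are defined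
  through representatives of the coordinates, on which they do not depend; and a functional is
  determined by its values on the unit vectors, which gives the coefficients.\<close>

lemma dual_free_module_presentation:
  assumes R: "ring_presentation \<pi> R"
    and I: "finite I" and a: "inj_on a I"
  defines "e \<equiv> \<lambda>f. \<lambda>i\<in>I. \<pi> (coef f (a i))"
  obtains \<psi> where "module_presentation \<pi> R \<psi> UNIV (dual_module R (free_module R I))"
    "\<And>f. \<psi> f \<in> extensional (carrier (free_module R I))"
    "\<And>f h. \<psi> f (e h) = \<pi> (\<Sum>i\<in>I. coef f (a i) * coef h (a i))"
proof -
  define F where "F = free_module R I"
  note R = R ring_presentationD[OF R]
  have pres: "module_presentation \<pi> R e UNIV F"
    unfolding e_def F_def by (rule free_module_presentation[OF R(1) I a]) auto
  note P = module_presentationD[OF pres]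
  define \<psi> where "\<psi> f = (\<lambda>w\<in>carrier F. \<pi> (\<Sum>i\<in>I. coef f (a i) * inv_into UNIV \<pi> (w i)))" for f
  have inv_eq: "\<pi> (\<Sum>i\<in>I. t i * inv_into UNIV \<pi> (\<pi> (s i))) = \<pi> (\<Sum>i\<in>I. t i * s i)" for s t
    using I
  proof (induction I)
    case (insert i I)
    have "\<pi> (t i * inv_into UNIV \<pi> (\<pi> (s i))) = \<pi> (t i * s i)"
      by (simp add: R(6)[symmetric] f_inv_into_f)
    then show ?case using insert by (simp add: R(5)[symmetric])
  qed simp
  have \<psi>: "\<psi> f (e h) = \<pi> (\<Sum>i\<in>I. coef f (a i) * coef h (a i))" for f h
  proof -
    have "\<psi> f (e h) = \<pi> (\<Sum>i\<in>I. coef f (a i) * inv_into UNIV \<pi> (\<pi> (coef h (a i))))"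
      using P(5) by (auto simp: \<psi>_def e_def intro!: arg_cong[where f = \<pi>] sum.cong)
    then show ?thesis by (simp add: inv_eq)
  qed
  have ext: "\<psi> f \<in> extensional (carrier F)" for f by (simp add: \<psi>_def)
  have in_dual: "\<psi> f \<in> carrier (dual_module R F)" for f
    using ext P(5,7,8) \<psi> R(2,5,6)
    by (auto simp: dual_module_def module_hom_def hom_def regular_module_def lookup_add
          algebra_simps sum.distrib sum_distrib_left)
  have surj: "\<phi> \<in> range \<psi>" if \<phi>: "\<phi> \<in> carrier (dual_module R F)" for \<phi>
  proof -
    have ext': "\<phi> \<in> extensional (carrier F)" and hom: "\<phi> (e f) \<in> range \<pi>"
      "\<phi> (e (f + g)) = \<phi> (e f) \<oplus>\<^bsub>R\<^esub> \<phi> (e g)" "\<phi> (e (mscale s f)) = \<pi> s \<otimes>\<^bsub>R\<^esub> \<phi> (e f)" for f g s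
    proof -
      have \<phi>_hom: "\<And>x. x \<in> carrier F \<Longrightarrow> \<phi> x \<in> carrier R"
        "\<And>x y. x \<in> carrier F \<Longrightarrow> y \<in> carrier F \<Longrightarrow> \<phi> (x \<oplus>\<^bsub>F\<^esub> y) = \<phi> x \<oplus>\<^bsub>R\<^esub> \<phi> y"
        "\<And>r x. r \<in> carrier R \<Longrightarrow> x \<in> carrier F \<Longrightarrow> \<phi> (r \<odot>\<^bsub>F\<^esub> x) = r \<otimes>\<^bsub>R\<^esub> \<phi> x"
        and "\<phi> \<in> extensional (carrier F)"
        using \<phi> by (auto simp: dual_module_def module_hom_def hom_def regular_module_def Pi_def)
      moreover have "e f \<in> carrier F" for f using P(5) by auto
      ultimately show "\<phi> \<in> extensional (carrier F)" "\<phi> (e f) \<in> range \<pi>"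
        "\<phi> (e (f + g)) = \<phi> (e f) \<oplus>\<^bsub>R\<^esub> \<phi> (e g)" "\<phi> (e (mscale s f)) = \<pi> s \<otimes>\<^bsub>R\<^esub> \<phi> (e f)" for f g s
        using P(7)[of f g] P(8)[of f s] R(2,7) by (metis UNIV_I rangeI)+
    qed
    define s where "s \<alpha> = inv_into UNIV \<pi> (\<phi> (e (Poly_Mapping.single \<alpha> 1)))" for \<alpha>
    have s: "\<pi> (s \<alpha>) = \<phi> (e (Poly_Mapping.single \<alpha> 1))" for \<alpha>
      using hom(1) by (simp add: s_def f_inv_into_f)
    let ?f = "\<Sum>i\<in>I. Poly_Mapping.single (a i) (s (a i))"
    have cf: "coef ?f (a i) = s (a i)" if "i \<in> I" for i
    proof -
      have "coef ?f (a i) = (\<Sum>j\<in>I. if j = i then s (a j) else 0)"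
        unfolding lookup_sum
        by (rule sum.cong) (use that a in \<open>auto simp: lookup_single when_def inj_on_def\<close>)
      then show ?thesis using that I by simp
    qed
    have zero: "\<phi> (e 0) = \<pi> 0"
      using hom(3)[of 0 0] hom(1)[of 0] by (auto simp: R(6))
    have "\<phi> (e h) = \<psi> ?f (e h)" for h
    proof (induction h rule: poly_mapping_additive_induct)
      case (add f g)
      then show ?case
        by (simp add: hom(2) \<psi> R(5) lookup_add algebra_simps sum.distrib)
    next
      case (single \<alpha> t)
      show "\<phi> (e (Poly_Mapping.single \<alpha> t)) = \<psi> ?f (e (Poly_Mapping.single \<alpha> t))"
      proof (cases "\<alpha> \<in> a ` I")
        case True
        then obtain i where i: "i \<in> I" "\<alpha> = a i" by auto
        have "Poly_Mapping.single \<alpha> t = mscale t (Poly_Mapping.single \<alpha> 1)"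
          by (simp add: mscale_def mult_single)
        then have "\<phi> (e (Poly_Mapping.single \<alpha> t)) = \<pi> (t * s \<alpha>)"
          by (simp add: hom(3) s[symmetric] R(6))
        moreover have "(\<Sum>j\<in>I. coef ?f (a j) * coef (Poly_Mapping.single \<alpha> t) (a j))
            = (\<Sum>j\<in>I. if j = i then s (a j) * t else 0)"
          by (rule sum.cong) (use i a cf in \<open>auto simp: lookup_single when_def inj_on_def\<close>)
        ultimately show ?thesis using i I by (simp add: \<psi> mult.commute)
      next
        case False
        then have "e (Poly_Mapping.single \<alpha> t) = e 0"
          by (auto simp: e_def lookup_single when_def restrict_def fun_eq_iff)
        then show ?thesis by (simp add: zero \<psi>)
      qed
    qed
    then have "\<phi> = \<psi> ?f"
      using P(5) by (intro extensionalityI[OF ext' ext]) auto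
    then show ?thesis by blast
  qed
  have "module_presentation \<pi> R \<psi> UNIV (dual_module R F)"
    unfolding module_presentation_def
  proof (intro conjI ballI allI)
    show "carrier (dual_module R F) = range \<psi>" using in_dual surj by auto
    show "\<zero>\<^bsub>dual_module R F\<^esub> = \<psi> 0"
      by (auto simp: dual_module_def P(5) \<psi> R intro!: extensionalityI[OF _ ext])
    show "\<psi> (f + g) = \<psi> f \<oplus>\<^bsub>dual_module R F\<^esub> \<psi> g" for f g
      by (auto simp: dual_module_def P(5) \<psi> R lookup_add algebra_simps sum.distrib intro!: extensionalityI[OF ext])
    show "\<psi> (mscale s f) = \<pi> s \<odot>\<^bsub>dual_module R F\<^esub> \<psi> f" for s f
      by (auto simp: dual_module_def P(5) \<psi> R algebra_simps sum_distrib_left intro!: extensionalityI[OF ext])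
  qed (use R in auto)
  then show ?thesis using that ext \<psi> unfolding F_def by blast
qed

section \<open>Matrices and their transposes\<close>

text \<open>If the relations between the generators \<open>\<alpha>\<close> of \<open>M\<close> are the combinations of the columns of the matrix
  \<open>c\<close>, then \<open>M\<close> is the cokernel of \<open>c\<close>, and its transpose is the cokernel of the transposed
  matrix, whose relations are the combinations of the rows of \<open>c\<close>. Both hypotheses compare coefficients
  after applying \<open>\<pi>\<close>, so no homomorphisms of modules have to be constructed by the user.\<close>

lemma is_transposeI:
  fixes c :: "('n \<Rightarrow>\<^sub>0 nat) \<Rightarrow> ('n \<Rightarrow>\<^sub>0 nat) \<Rightarrow> 's::comm_ring_1"
    and \<gamma> :: "('n, 's) mpoly \<Rightarrow> 'b" and \<nu> :: "('n, 's) mpoly \<Rightarrow> 'c"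
  assumes fin: "finite A" "finite B"
    and M: "module_presentation \<pi> R \<gamma> D M" "\<And>\<alpha> s. \<alpha> \<in> A \<Longrightarrow> Poly_Mapping.single \<alpha> s \<in> D"
      "\<And>h. h \<in> D \<Longrightarrow> \<gamma> h = \<zero>\<^bsub>M\<^esub> \<longleftrightarrow>
         (\<exists>w. \<forall>\<alpha>\<in>A. \<pi> (coef h \<alpha>) = \<pi> (\<Sum>\<beta>\<in>B. c \<alpha> \<beta> * coef w \<beta>))"
    and N: "module_presentation \<pi> R \<nu> UNIV N"
      "\<And>f. \<nu> f = \<zero>\<^bsub>N\<^esub> \<longleftrightarrow> (\<exists>u. \<forall>\<beta>\<in>B. \<pi> (coef f \<beta>) = \<pi> (\<Sum>\<alpha>\<in>A. coef u \<alpha> * c \<alpha> \<beta>))"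
  shows "is_transpose R M N"
proof -
  note DM = module_presentationD[OF M(1)]
  note R = DM(1) ring_presentationD[OF DM(1)]
  obtain a where a: "bij_betw a {..<card A} A"
    using ex_bij_betw_nat_finite[OF fin(1)] by (auto simp: atLeast0LessThan)
  obtain b where b: "bij_betw b {..<card B} B"
    using ex_bij_betw_nat_finite[OF fin(2)] by (auto simp: atLeast0LessThan)
  define P0 where "P0 = free_module R {..<card A}"
  define P1 where "P1 = free_module R {..<card B}"
  define e0 where "e0 = (\<lambda>h::('n, 's) mpoly. \<lambda>i\<in>{..<card A}. \<pi> (coef h (a i)))"
  define e1 where "e1 = (\<lambda>h::('n, 's) mpoly. \<lambda>i\<in>{..<card B}. \<pi> (coef h (b i)))"
  have inj: "inj_on a {..<card A}" "inj_on b {..<card B}" using a b by (auto simp: bij_betw_def)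
  have pres0: "module_presentation \<pi> R e0 D P0"
    unfolding e0_def P0_def
    by (rule free_module_presentation[OF R(1) _ inj(1)]) (use DM(2-4) M(2) bij_betwE[OF a] in auto)
  have pres0': "module_presentation \<pi> R e0 UNIV P0"
    unfolding e0_def P0_def by (rule free_module_presentation[OF R(1) _ inj(1)]) auto
  have pres1: "module_presentation \<pi> R e1 UNIV P1"
    unfolding e1_def P1_def by (rule free_module_presentation[OF R(1) _ inj(2)]) auto
  note D0 = module_presentationD[OF pres0] and D0' = module_presentationD[OF pres0']
    and D1 = module_presentationD[OF pres1]
  have e0_eq: "e0 h = e0 h' \<longleftrightarrow> (\<forall>\<alpha>\<in>A. \<pi> (coef h \<alpha>) = \<pi> (coef h' \<alpha>))" for h h'
  proof -
    have "e0 h = e0 h' \<longleftrightarrow> (\<forall>\<alpha>\<in>a ` {..<card A}. \<pi> (coef h \<alpha>) = \<pi> (coef h' \<alpha>))"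
      by (auto simp: e0_def fun_eq_iff restrict_def)
    then show ?thesis by (simp only: bij_betw_imp_surj_on[OF a])
  qed
  have e1_eq: "e1 h = e1 h' \<longleftrightarrow> (\<forall>\<beta>\<in>B. \<pi> (coef h \<beta>) = \<pi> (coef h' \<beta>))" for h h'
  proof -
    have "e1 h = e1 h' \<longleftrightarrow> (\<forall>\<beta>\<in>b ` {..<card B}. \<pi> (coef h \<beta>) = \<pi> (coef h' \<beta>))"
      by (auto simp: e1_def fun_eq_iff restrict_def)
    then show ?thesis by (simp only: bij_betw_imp_surj_on[OF b])
  qed
  define C where "C w = (\<Sum>\<alpha>\<in>A. Poly_Mapping.single \<alpha> (\<Sum>\<beta>\<in>B. c \<alpha> \<beta> * coef w \<beta>))" for w :: "('n, 's) mpoly"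
  define C' where "C' u = (\<Sum>\<beta>\<in>B. Poly_Mapping.single \<beta> (\<Sum>\<alpha>\<in>A. coef u \<alpha> * c \<alpha> \<beta>))" for u :: "('n, 's) mpoly"
  have coef_C: "\<alpha> \<in> A \<Longrightarrow> coef (C w) \<alpha> = (\<Sum>\<beta>\<in>B. c \<alpha> \<beta> * coef w \<beta>)" for \<alpha> w
    by (simp add: C_def coef_sum_singles fin)
  have coef_C': "\<beta> \<in> B \<Longrightarrow> coef (C' u) \<beta> = (\<Sum>\<alpha>\<in>A. coef u \<alpha> * c \<alpha> \<beta>)" for \<beta> u
    by (simp add: C'_def coef_sum_singles fin)
  have \<pi>_sum: "\<pi> (\<Sum>x\<in>Y. s x * t x) = \<pi> (\<Sum>x\<in>Y. s x * t' x)"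
    if "\<And>x. x \<in> Y \<Longrightarrow> \<pi> (t x) = \<pi> (t' x)" for Y :: "('n \<Rightarrow>\<^sub>0 nat) set" and s t t'
    using that
  proof (induction Y rule: infinite_finite_induct)
    case (insert x Y)
    have "\<pi> (s x * t x) = \<pi> (s x * t' x)" using insert.prems[of x] by (simp add: R(6)[symmetric])
    then show ?case using insert by (simp add: R(5)[symmetric])
  qed auto
  have C_cong: "e0 (C w) = e0 (C w')" if "e1 w = e1 w'" for w w'
    unfolding e0_eq using that e1_eq[of w w'] by (auto simp: coef_C intro!: \<pi>_sum)
  have in_D: "C w \<in> D" for w
  proof -
    have "(\<Sum>\<alpha>\<in>Y. Poly_Mapping.single \<alpha> (s \<alpha>)) \<in> D" if "Y \<subseteq> A" for Y s
      using finite_subset[OF that fin(1)] that by (induction Y) (auto intro: DM(2,3) M(2))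
    then show ?thesis by (simp add: C_def)
  qed
  have ker: "\<gamma> h = \<zero>\<^bsub>M\<^esub> \<longleftrightarrow> (\<exists>w. e0 h = e0 (C w))" if "h \<in> D" for h
    using M(3)[OF that] by (simp add: e0_eq coef_C)
  have \<gamma>_cong: "\<gamma> h = \<gamma> h'" if "h \<in> D" "h' \<in> D" "e0 h = e0 h'" for h h'
  proof -
    have "e0 (h - h') = e0 (C 0)"
      using module_presentation_eq_iff[OF pres0 that(1,2)] that(3) D0(6) by (simp add: C_def)
    then have "\<gamma> (h - h') = \<zero>\<^bsub>M\<^esub>" using ker[OF DM(10)[OF that(1,2)]] by blast
    then show ?thesis using module_presentation_eq_iff[OF M(1) that(1,2)] by simp
  qed
  \<comment> \<open>The homomorphisms of the presentation are induced by operations on polynomials, evaluated at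
    arbitrary preimages.\<close>
  define f where "f x = e0 (C (inv_into UNIV e1 x))" for x
  define g where "g x = \<gamma> (inv_into D e0 x)" for x
  have f: "f (e1 w) = e0 (C w)" for w
    unfolding f_def by (rule C_cong) (simp add: f_inv_into_f)
  have g: "g (e0 h) = \<gamma> h" if "h \<in> D" for h
    unfolding g_def using that by (intro \<gamma>_cong) (auto simp: inv_into_into f_inv_into_f)
  have C_add: "C (w + w') = C w + C w'" for w w'
    by (simp add: C_def lookup_add algebra_simps sum.distrib single_add)
  have C_scale: "C (mscale s w) = mscale s (C w)" for s w
    by (rule poly_mapping_eqI) (simp add: C_def coef_sum_singles fin sum_distrib_left algebra_simps)
  have C'_add: "C' (w + w') = C' w + C' w'" for w w'
    by (simp add: C'_def lookup_add algebra_simps sum.distrib single_add)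
  have C'_scale: "C' (mscale s w) = mscale s (C' w)" for s w
    by (rule poly_mapping_eqI) (simp add: C'_def coef_sum_singles fin sum_distrib_left algebra_simps)
  have f_hom: "f \<in> module_hom R P1 P0"
    using f D0'(5,7,8) D1(5,7,8) R(2) by (auto simp: module_hom_def hom_def C_add C_scale)
  have g_hom: "g \<in> module_hom R P0 M"
    using g D0(3,4,5,7,8) DM(5,7,8) R(2) by (auto simp: module_hom_def hom_def)
  have g_surj: "g ` carrier P0 = carrier M"
    using g by (force simp: D0(5) DM(5))
  have exact: "a_kernel P0 M g = f ` carrier P1"
  proof -
    have "x \<in> a_kernel P0 M g \<longleftrightarrow> x \<in> f ` carrier P1" for x
    proof -
      have "x \<in> a_kernel P0 M g \<longleftrightarrow> (\<exists>h\<in>D. x = e0 h \<and> \<gamma> h = \<zero>\<^bsub>M\<^esub>)"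
        using g by (auto simp: a_kernel_def' D0(5))
      also have "\<dots> \<longleftrightarrow> (\<exists>w. x = e0 (C w))"
        using ker in_D by blast
      also have "\<dots> \<longleftrightarrow> x \<in> f ` carrier P1"
        by (auto simp: D1(5) f image_image)
      finally show ?thesis .
    qed
    then show ?thesis by blast
  qed
  obtain \<psi>0 where \<psi>0: "module_presentation \<pi> R \<psi>0 UNIV (dual_module R P0)"
    "\<And>u. \<psi>0 u \<in> extensional (carrier P0)"
    "\<And>u h. \<psi>0 u (e0 h) = \<pi> (\<Sum>i<card A. coef u (a i) * coef h (a i))"
    unfolding P0_def e0_def by (rule dual_free_module_presentation[OF R(1) finite_lessThan inj(1)]) blast
  obtain \<psi>1 where \<psi>1: "module_presentation \<pi> R \<psi>1 UNIV (dual_module R P1)"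
    "\<And>u. \<psi>1 u \<in> extensional (carrier P1)"
    "\<And>u h. \<psi>1 u (e1 h) = \<pi> (\<Sum>i<card B. coef u (b i) * coef h (b i))"
    unfolding P1_def e1_def by (rule dual_free_module_presentation[OF R(1) finite_lessThan inj(2)]) blast
  have \<psi>0': "\<psi>0 u (e0 h) = \<pi> (\<Sum>\<alpha>\<in>A. coef u \<alpha> * coef h \<alpha>)" for u h
    unfolding \<psi>0(3) using sum.reindex_bij_betw[OF a, of "\<lambda>\<alpha>. coef u \<alpha> * coef h \<alpha>"] by simp
  have \<psi>1': "\<psi>1 u (e1 h) = \<pi> (\<Sum>\<beta>\<in>B. coef u \<beta> * coef h \<beta>)" for u h
    unfolding \<psi>1(3) using sum.reindex_bij_betw[OF b, of "\<lambda>\<alpha>. coef u \<alpha> * coef h \<alpha>"] by simp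
  note Dd0 = module_presentationD[OF \<psi>0(1)] and Dd1 = module_presentationD[OF \<psi>1(1)]
  \<comment> \<open>Exchanging the order of summation identifies the dual of the matrix with its transpose.\<close>
  have dual_f: "dual_map P1 f (\<psi>0 u) = \<psi>1 (C' u)" for u
  proof (rule extensionalityI[where A = "carrier P1"])
    fix x assume "x \<in> carrier P1"
    then obtain w where w: "x = e1 w" using D1(5) by auto
    have "(\<Sum>\<alpha>\<in>A. coef u \<alpha> * coef (C w) \<alpha>) = (\<Sum>\<alpha>\<in>A. \<Sum>\<beta>\<in>B. coef u \<alpha> * c \<alpha> \<beta> * coef w \<beta>)"
      by (rule sum.cong) (simp_all add: coef_C sum_distrib_left mult.assoc)
    also have "\<dots> = (\<Sum>\<beta>\<in>B. \<Sum>\<alpha>\<in>A. coef u \<alpha> * c \<alpha> \<beta> * coef w \<beta>)"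
      by (rule sum.swap)
    also have "\<dots> = (\<Sum>\<beta>\<in>B. coef (C' u) \<beta> * coef w \<beta>)"
      by (rule sum.cong) (simp_all add: coef_C' sum_distrib_right)
    finally show "dual_map P1 f (\<psi>0 u) x = \<psi>1 (C' u) x"
      using \<open>x \<in> carrier P1\<close> by (simp add: dual_map_def w f \<psi>0' \<psi>1')
  qed (use \<psi>1(2) in \<open>auto simp: dual_map_def\<close>)
  define L where "L = dual_map P1 f ` carrier (dual_module R P0)"
  have L: "L = range (\<lambda>u. \<psi>1 (C' u))"
    unfolding L_def Dd0(5) image_image dual_f ..
  have zero: "C' 0 = 0" by (simp add: C'_def)
  have presL: "module_presentation \<pi> R (\<lambda>u. L +>\<^bsub>dual_module R P1\<^esub> \<psi>1 u) UNIV (quot_module (dual_module R P1) L)"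
    and kerL: "\<And>u. L +>\<^bsub>dual_module R P1\<^esub> \<psi>1 u = \<zero>\<^bsub>quot_module (dual_module R P1) L\<^esub> \<longleftrightarrow> \<psi>1 u \<in> L"
  proof -
    have 1: "L \<subseteq> carrier (dual_module R P1)" using L Dd1(5) by auto
    have 2: "\<zero>\<^bsub>dual_module R P1\<^esub> \<in> L" using L Dd1(6) zero by (metis rangeI)
    have 3: "x \<oplus>\<^bsub>dual_module R P1\<^esub> y \<in> L" if "x \<in> L" "y \<in> L" for x y
    proof -
      from that obtain u v where "x = \<psi>1 (C' u)" "y = \<psi>1 (C' v)" using L by auto
      then have "x \<oplus>\<^bsub>dual_module R P1\<^esub> y = \<psi>1 (C' (u + v))" by (simp add: Dd1(7) C'_add)
      then show ?thesis using L by blast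
    qed
    have 4: "\<pi> s \<odot>\<^bsub>dual_module R P1\<^esub> x \<in> L" if "x \<in> L" for s x
    proof -
      from that obtain u where "x = \<psi>1 (C' u)" using L by auto
      then have "\<pi> s \<odot>\<^bsub>dual_module R P1\<^esub> x = \<psi>1 (C' (mscale s u))" by (simp add: Dd1(8) C'_scale)
      then show ?thesis using L by blast
    qed
    show "module_presentation \<pi> R (\<lambda>u. L +>\<^bsub>dual_module R P1\<^esub> \<psi>1 u) UNIV (quot_module (dual_module R P1) L)"
      by (rule quotient_presentation(1)[OF \<psi>1(1) 1 2 3 4])
    show "\<And>u. L +>\<^bsub>dual_module R P1\<^esub> \<psi>1 u = \<zero>\<^bsub>quot_module (dual_module R P1) L\<^esub> \<longleftrightarrow> \<psi>1 u \<in> L"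
      by (rule quotient_presentation(2)[OF \<psi>1(1) 1 2 3 4]) auto
  qed
  have \<psi>1_eq: "\<psi>1 u = \<psi>1 v \<longleftrightarrow> (\<forall>\<beta>\<in>B. \<pi> (coef u \<beta>) = \<pi> (coef v \<beta>))" for u v
  proof
    assume eq: "\<psi>1 u = \<psi>1 v"
    show "\<forall>\<beta>\<in>B. \<pi> (coef u \<beta>) = \<pi> (coef v \<beta>)"
    proof
      fix \<beta> assume \<beta>: "\<beta> \<in> B"
      have "\<psi>1 u (e1 (Poly_Mapping.single \<beta> 1)) = \<pi> (coef u \<beta>)" for u
      proof -
        have "(\<Sum>\<alpha>\<in>B. coef u \<alpha> * coef (Poly_Mapping.single \<beta> 1) \<alpha>) = (\<Sum>\<alpha>\<in>B. if \<alpha> = \<beta> then coef u \<alpha> else 0)"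
          by (rule sum.cong) (auto simp: lookup_single when_def)
        then show ?thesis using \<beta> fin(2) by (simp add: \<psi>1')
      qed
      then show "\<pi> (coef u \<beta>) = \<pi> (coef v \<beta>)" using eq by metis
    qed
  next
    assume *: "\<forall>\<beta>\<in>B. \<pi> (coef u \<beta>) = \<pi> (coef v \<beta>)"
    show "\<psi>1 u = \<psi>1 v"
    proof (rule extensionalityI[OF \<psi>1(2) \<psi>1(2)])
      fix x assume "x \<in> carrier P1"
      then obtain w where w: "x = e1 w" using D1(5) by auto
      show "\<psi>1 u x = \<psi>1 v x"
        using \<pi>_sum[of B "coef u" "coef v" "coef w"] * by (simp add: w \<psi>1' mult.commute)
    qed
  qed
  have "module_isomorphic R N (quot_module (dual_module R P1) L)"
  proof (rule isomorphic_presentations[OF N(1) presL])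
    fix h
    have "\<psi>1 h \<in> L \<longleftrightarrow> (\<exists>u. \<forall>\<beta>\<in>B. \<pi> (coef h \<beta>) = \<pi> (\<Sum>\<alpha>\<in>A. coef u \<alpha> * c \<alpha> \<beta>))"
      by (auto simp: L \<psi>1_eq coef_C')
    then show "\<nu> h = \<zero>\<^bsub>N\<^esub> \<longleftrightarrow> L +>\<^bsub>dual_module R P1\<^esub> \<psi>1 h = \<zero>\<^bsub>quot_module (dual_module R P1) L\<^esub>"
      by (simp only: N(2) kerL)
  qed
  then show ?thesis
    unfolding is_transpose_def Let_def
    using module_presentation_module[OF M(1)] module_presentation_module[OF N(1)]
      f_hom g_hom g_surj exact unfolding P0_def P1_def L_def by blast
qed

section \<open>Polynomials: induction, evaluation, convolution, order\<close>

abbreviation const :: "'k::zero \<Rightarrow> ('n \<Rightarrow>\<^sub>0 nat) \<Rightarrow>\<^sub>0 'k"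
  where "const \<equiv> Poly_Mapping.single 0"

definition var :: "'n \<Rightarrow> ('n, 'k::comm_ring_1) mpoly"
  where "var i = Poly_Mapping.single (Poly_Mapping.single i 1) 1"

definition unital_hom :: "('a::comm_ring_1 \<Rightarrow> 'b::comm_ring_1) \<Rightarrow> bool"
  where "unital_hom \<phi> \<longleftrightarrow> \<phi> 1 = 1 \<and> (\<forall>a b. \<phi> (a + b) = \<phi> a + \<phi> b \<and> \<phi> (a * b) = \<phi> a * \<phi> b)"

lemma unital_homD:
  assumes "unital_hom \<phi>"
  shows "\<phi> 1 = 1" "\<phi> (a + b) = \<phi> a + \<phi> b" "\<phi> (a * b) = \<phi> a * \<phi> b" "\<phi> 0 = 0"
    "\<phi> (a - b) = \<phi> a - \<phi> b" "\<phi> (- a) = - \<phi> a"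
proof -
  have add: "\<phi> (a + b) = \<phi> a + \<phi> b" for a b using assms by (simp add: unital_hom_def)
  show zero: "\<phi> 0 = 0" using add[of 0 0] by simp
  show "\<phi> (a - b) = \<phi> a - \<phi> b" using add[of "a - b" b] by simp
  show "\<phi> (- a) = - \<phi> a" using add[of "- a" a] zero by (simp add: eq_neg_iff_add_eq_0)
qed (use assms in \<open>auto simp: unital_hom_def\<close>)

lemma unital_hom_const: "unital_hom (const :: 'k::comm_ring_1 \<Rightarrow> ('n, 'k) mpoly)"
  by (simp add: unital_hom_def single_add mult_single)

lemma unital_hom_comp: "unital_hom \<phi> \<Longrightarrow> unital_hom \<psi> \<Longrightarrow> unital_hom (\<lambda>a. \<phi> (\<psi> a))"
  by (simp add: unital_hom_def)

text \<open>Generation of the polynomial ring by constants and variables; this replaces the universal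
  property when two homomorphisms are to be compared.\<close>

lemma mpoly_induct [case_names const var add mult]:
  fixes f :: "('n, 'k::comm_ring_1) mpoly"
  assumes const: "\<And>c. P (const c)" and var: "\<And>i. P (var i)"
    and add: "\<And>f g. P f \<Longrightarrow> P g \<Longrightarrow> P (f + g)" and mult: "\<And>f g. P f \<Longrightarrow> P g \<Longrightarrow> P (f * g)"
  shows "P f"
proof -
  have mono: "P (Poly_Mapping.single \<mu> 1)" for \<mu> :: "'n \<Rightarrow>\<^sub>0 nat"
  proof (induction \<mu> rule: poly_mapping_additive_induct)
    case (single i k)
    show ?case
    proof (induction k)
      case 0
      then show ?case using const[of 1] by simp
    next
      case (Suc k)
      have "Poly_Mapping.single (Poly_Mapping.single i (Suc k)) (1::'k)
          = var i * Poly_Mapping.single (Poly_Mapping.single i k) 1"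
        by (simp add: var_def mult_single single_add[symmetric])
      then show ?case using Suc var[of i] mult by simp
    qed
  next
    case (add \<mu> \<nu>)
    have "Poly_Mapping.single (\<mu> + \<nu>) (1::'k) = Poly_Mapping.single \<mu> 1 * Poly_Mapping.single \<nu> 1"
      by (simp add: mult_single)
    then show ?case using add mult by simp
  qed
  have "P (Poly_Mapping.single \<mu> c)" for \<mu> c
  proof -
    have "Poly_Mapping.single \<mu> c = const c * Poly_Mapping.single \<mu> 1" by (simp add: mult_single)
    then show ?thesis using mult[OF const mono] by simp
  qed
  then show ?thesis by (induction f rule: poly_mapping_additive_induct) (auto intro: add)
qed

definition meval :: "('c::comm_ring_1 \<Rightarrow> 'a::comm_ring_1) \<Rightarrow> ('n::finite \<Rightarrow> 'a) \<Rightarrow> ('n, 'c) mpoly \<Rightarrow> 'a"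
  where "meval \<phi> y f =
    (\<Sum>\<mu>\<in>Poly_Mapping.keys f. \<phi> (coef f \<mu>) * (\<Prod>i\<in>UNIV. y i ^ coef \<mu> i))"

lemma meval_hom:
  assumes "unital_hom \<phi>"
  shows "unital_hom (meval \<phi> y)" and "meval \<phi> y (const c) = \<phi> c" and "meval \<phi> y (var i) = y i"
    and "meval \<phi> y (Poly_Mapping.single \<mu> c) = \<phi> c * (\<Prod>i\<in>UNIV. y i ^ coef \<mu> i)"
proof -
  note \<phi> = unital_homD[OF assms]
  have add: "meval \<phi> y (f + g) = meval \<phi> y f + meval \<phi> y g" for f g
    unfolding meval_def by (rule setsum_keys_plus_distrib) (simp_all add: \<phi> algebra_simps)
  show monomial: "meval \<phi> y (Poly_Mapping.single \<mu> c) = \<phi> c * (\<Prod>i\<in>UNIV. y i ^ coef \<mu> i)" for \<mu> c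
    by (simp add: meval_def \<phi>(4))
  have mult: "meval \<phi> y (f * g) = meval \<phi> y f * meval \<phi> y g" for f g
  proof (induction f rule: poly_mapping_additive_induct)
    case (single \<mu> c)
    show ?case
      by (induction g rule: poly_mapping_additive_induct)
        (simp_all add: mult_single monomial \<phi> lookup_add power_add prod.distrib add algebra_simps)
  qed (simp add: add algebra_simps)
  show const: "meval \<phi> y (const c) = \<phi> c" for c by (simp add: monomial)
  show "unital_hom (meval \<phi> y)"
    using const[of 1] \<phi>(1) by (simp add: unital_hom_def add mult)
  have "(\<Prod>j\<in>UNIV. y j ^ coef (Poly_Mapping.single i 1) j) = (\<Prod>j\<in>UNIV. if j = i then y j else 1)"
    by (rule prod.cong) (auto simp: lookup_single when_def)
  then show "meval \<phi> y (var i) = y i" by (simp add: var_def monomial \<phi>(1))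
qed

lemma coef_mult_single:
  "coef (f * Poly_Mapping.single \<beta> s) \<alpha> = (if mle \<beta> \<alpha> then coef f (\<alpha> - \<beta>) * s else 0)"
  for f :: "('n, 'k::comm_ring_1) mpoly"
proof (induction f rule: poly_mapping_additive_induct)
  case (single \<nu> c)
  have "\<nu> + \<beta> = \<alpha> \<longleftrightarrow> mle \<beta> \<alpha> \<and> \<nu> = \<alpha> - \<beta>"
  proof
    assume "\<nu> + \<beta> = \<alpha>"
    then show "mle \<beta> \<alpha> \<and> \<nu> = \<alpha> - \<beta>" by (auto simp: mle_def lookup_add)
  next
    assume "mle \<beta> \<alpha> \<and> \<nu> = \<alpha> - \<beta>"
    then show "\<nu> + \<beta> = \<alpha>" by (intro poly_mapping_eqI) (auto simp: mle_def lookup_add lookup_minus)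
  qed
  then show ?case by (auto simp: mult_single lookup_single when_def)
qed (simp add: lookup_add algebra_simps)

lemma finite_msize_le: "finite {\<alpha> :: 'n::finite \<Rightarrow>\<^sub>0 nat. msize \<alpha> \<le> k}"
proof (rule finite_imageD)
  show "finite (coef ` {\<alpha> :: 'n \<Rightarrow>\<^sub>0 nat. msize \<alpha> \<le> k})"
  proof (rule finite_subset)
    show "coef ` {\<alpha> :: 'n \<Rightarrow>\<^sub>0 nat. msize \<alpha> \<le> k} \<subseteq> UNIV \<rightarrow>\<^sub>E {..k}"
    proof
      fix x assume "x \<in> coef ` {\<alpha> :: 'n \<Rightarrow>\<^sub>0 nat. msize \<alpha> \<le> k}"
      then obtain \<alpha> :: "'n \<Rightarrow>\<^sub>0 nat" where \<alpha>: "x = coef \<alpha>" "msize \<alpha> \<le> k" by auto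
      have "coef \<alpha> i \<le> msize \<alpha>" for i unfolding msize_def by (rule member_le_sum) auto
      then show "x \<in> UNIV \<rightarrow>\<^sub>E {..k}" using \<alpha>(1) le_trans[OF _ \<alpha>(2)] by auto
    qed
    show "finite (UNIV \<rightarrow>\<^sub>E {..k} :: ('n \<Rightarrow> nat) set)" by (rule finite_PiE) auto
  qed
  show "inj_on coef {\<alpha> :: 'n \<Rightarrow>\<^sub>0 nat. msize \<alpha> \<le> k}"
    by (rule inj_onI, rule poly_mapping_eqI) simp
qed

lemma msize_add: "msize (\<alpha> + \<beta>) = msize \<alpha> + msize \<beta>"
  by (simp add: msize_def lookup_add sum.distrib)

lemma msize_mono: "mle \<beta> \<alpha> \<Longrightarrow> msize \<beta> \<le> msize \<alpha>"
  unfolding mle_def msize_def by (rule sum_mono) auto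

lemma mle_add_diff: "mle \<beta> \<alpha> \<Longrightarrow> \<beta> + (\<alpha> - \<beta>) = \<alpha>"
  by (rule poly_mapping_eqI) (simp add: mle_def lookup_add lookup_minus)

lemma mle_zero_right [simp]: "mle \<beta> 0 \<longleftrightarrow> \<beta> = 0"
  by (auto simp: mle_def poly_mapping_eq_iff fun_eq_iff)

lemma finite_mle: "finite {\<beta>. mle \<beta> \<alpha>}" for \<alpha> :: "'n::finite \<Rightarrow>\<^sub>0 nat"
  by (rule finite_subset[OF _ finite_msize_le[of "msize \<alpha>"]]) (auto intro: msize_mono)

lemma coef_mult:
  fixes f g :: "('n::finite, 'k::comm_ring_1) mpoly"
  shows "coef (f * g) \<alpha> = (\<Sum>\<beta> | mle \<beta> \<alpha>. coef f (\<alpha> - \<beta>) * coef g \<beta>)"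
proof (induction g rule: poly_mapping_additive_induct)
  case (single \<beta> s)
  have "(\<Sum>\<gamma> | mle \<gamma> \<alpha>. coef f (\<alpha> - \<gamma>) * coef (Poly_Mapping.single \<beta> s) \<gamma>)
      = (\<Sum>\<gamma> | mle \<gamma> \<alpha>. if \<gamma> = \<beta> then coef f (\<alpha> - \<gamma>) * s else 0)"
    by (rule sum.cong) (auto simp: lookup_single when_def)
  then show ?case using finite_mle[of \<alpha>] by (simp add: coef_mult_single)
qed (simp add: lookup_add algebra_simps sum.distrib)

lemma coef_mult_0: "coef (f * g) 0 = coef f 0 * coef g 0"
  for f g :: "('n::finite, 'k::comm_ring_1) mpoly"
  by (simp add: coef_mult)

lemma msize_zero [simp]: "msize 0 = 0"
  by (simp add: msize_def)

lemma msize_eq_0_iff [simp]: "msize \<alpha> = 0 \<longleftrightarrow> \<alpha> = 0"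
  by (auto simp: msize_def poly_mapping_eq_iff fun_eq_iff)

lemma mle_msize_less: "mle \<beta> \<alpha> \<Longrightarrow> \<beta> \<noteq> \<alpha> \<Longrightarrow> msize \<beta> < msize \<alpha>"
proof -
  assume le: "mle \<beta> \<alpha>" and ne: "\<beta> \<noteq> \<alpha>"
  have "\<beta> + (\<alpha> - \<beta>) = \<alpha>" by (rule mle_add_diff[OF le])
  then have "\<alpha> - \<beta> \<noteq> 0" "msize \<beta> + msize (\<alpha> - \<beta>) = msize \<alpha>"
    using ne by (auto simp flip: msize_add)
  then show ?thesis using msize_eq_0_iff[of "\<alpha> - \<beta>"] by linarith
qed

text \<open>The \<open>k\<close>-th power of the ideal generated by the variables, given by its coefficients.\<close>

definition order_ge :: "nat \<Rightarrow> ('n::finite, 'k::comm_ring_1) mpoly set"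
  where "order_ge k = {f. \<forall>\<alpha>. msize \<alpha> < k \<longrightarrow> coef f \<alpha> = 0}"

lemma order_ge_closed:
  "0 \<in> order_ge k" "f \<in> order_ge k \<Longrightarrow> g \<in> order_ge k \<Longrightarrow> f + g \<in> order_ge k"
  "f \<in> order_ge k \<Longrightarrow> mscale s f \<in> order_ge k"
  by (auto simp: order_ge_def lookup_add)

lemma order_ge_mono: "k \<le> l \<Longrightarrow> order_ge l \<subseteq> order_ge k"
  by (auto simp: order_ge_def)

lemma order_ge_0 [simp]: "order_ge 0 = UNIV"
  by (auto simp: order_ge_def)

lemma order_ge_mult:
  fixes f g :: "('n::finite, 'k::comm_ring_1) mpoly"
  assumes "f \<in> order_ge k" "g \<in> order_ge l"
  shows "f * g \<in> order_ge (k + l)"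
  unfolding order_ge_def
proof (intro CollectI allI impI)
  fix \<alpha> :: "'n \<Rightarrow>\<^sub>0 nat" assume \<alpha>: "msize \<alpha> < k + l"
  have "coef f (\<alpha> - \<beta>) * coef g \<beta> = 0" if "mle \<beta> \<alpha>" for \<beta>
  proof -
    have "msize \<beta> + msize (\<alpha> - \<beta>) = msize \<alpha>"
      using mle_add_diff[OF that] by (simp flip: msize_add)
    then have "msize (\<alpha> - \<beta>) < k \<or> msize \<beta> < l" using \<alpha> by linarith
    then show ?thesis using assms by (auto simp: order_ge_def)
  qed
  then show "coef (f * g) \<alpha> = 0" by (simp add: coef_mult)
qed

lemma var_order_ge: "var i \<in> order_ge 1"
proof -
  have "Poly_Mapping.single i (1::nat) \<noteq> 0" by (metis lookup_single_eq lookup_zero one_neq_zero)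
  then show ?thesis by (auto simp: order_ge_def var_def lookup_single when_def)
qed

text \<open>The step from one power of the ideal of the variables to the next: every monomial of
  degree greater than \<open>k\<close> is a variable times a monomial of degree at least \<open>k\<close>.\<close>

lemma order_ge_Suc_induct [consumes 1, case_names zero mult add]:
  fixes f :: "('n::finite, 'k::comm_ring_1) mpoly"
  assumes f: "f \<in> order_ge (Suc k)"
    and zero: "P 0" and mult: "\<And>g i. g \<in> order_ge k \<Longrightarrow> P (g * var i)"
    and add: "\<And>f g. P f \<Longrightarrow> P g \<Longrightarrow> P (f + g)"
  shows "P f"
proof -
  have single: "P (Poly_Mapping.single \<mu> s)" if \<mu>: "k < msize \<mu>" for \<mu> :: "'n \<Rightarrow>\<^sub>0 nat" and s :: 'k
  proof -
    have "\<mu> \<noteq> 0" using \<mu> msize_eq_0_iff[of \<mu>] by linarith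
    then obtain i where i: "coef \<mu> i \<noteq> 0" by (auto simp: poly_mapping_eq_iff fun_eq_iff)
    let ?e = "Poly_Mapping.single i (1::nat)"
    have \<mu>_eq: "\<mu> - ?e + ?e = \<mu>"
      by (rule poly_mapping_eqI) (use i in \<open>auto simp: lookup_add lookup_minus lookup_single when_def\<close>)
    have "(\<Sum>j\<in>UNIV. coef ?e j) = (\<Sum>j\<in>UNIV. if j = i then 1 else 0)"
      by (rule sum.cong) (auto simp: lookup_single when_def)
    then have "msize ?e = 1" by (simp add: msize_def)
    then have "k \<le> msize (\<mu> - ?e)" using \<mu> msize_add[of "\<mu> - ?e" ?e] \<mu>_eq by simp
    then have "Poly_Mapping.single (\<mu> - ?e) s \<in> order_ge k"
      by (auto simp: order_ge_def lookup_single when_def)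
    from mult[OF this, of i] show ?thesis by (simp add: var_def mult_single \<mu>_eq[simplified])
  qed
  have "P (\<Sum>\<mu>\<in>Y. Poly_Mapping.single \<mu> (coef f \<mu>))" if "finite Y" "Y \<subseteq> Poly_Mapping.keys f" for Y
    using that
  proof (induction Y)
    case (insert \<mu> Y)
    have "coef f \<mu> \<noteq> 0" using insert.prems by (auto simp: in_keys_iff)
    then have "k < msize \<mu>" using f by (auto simp: order_ge_def not_less less_Suc_eq_le intro: leI)
    then show ?case using insert single add by simp
  qed (simp add: zero)
  then show ?thesis using poly_mapping_sum_singles[of f] by (metis finite_keys order_refl)
qed

lemma prod_var_power:
  "(\<Prod>i\<in>UNIV. var i ^ coef \<mu> i) = (Poly_Mapping.single \<mu> 1 :: ('n::finite, 'k::comm_ring_1) mpoly)"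
proof (induction \<mu> rule: poly_mapping_additive_induct)
  case (single i k)
  have "(\<Prod>j\<in>UNIV. var j ^ coef (Poly_Mapping.single i k) j)
      = (\<Prod>j\<in>UNIV. if j = i then var j ^ k else (1 :: ('n, 'k) mpoly))"
    by (rule prod.cong) (auto simp: lookup_single when_def)
  moreover have "var i ^ k = (Poly_Mapping.single (Poly_Mapping.single i k) 1 :: ('n, 'k) mpoly)"
    by (induction k) (simp_all add: var_def mult_single single_add[symmetric])
  ultimately show ?case by simp
qed (simp add: lookup_add power_add prod.distrib mult_single)

section \<open>Taylor expansion\<close>

lemma partial_add: "partial i (f + g) = partial i f + partial i g"
  unfolding partial_def by (rule setsum_keys_plus_distrib) (simp_all add: algebra_simps single_add)

lemma partial_single:
  "partial i (Poly_Mapping.single \<mu> c) = Poly_Mapping.single (\<mu> - Poly_Mapping.single i 1) (of_nat (coef \<mu> i) * c)"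
  by (simp add: partial_def)

lemma coef_partial:
  "coef (partial i f) \<mu> = of_nat (coef \<mu> i + 1) * coef f (\<mu> + Poly_Mapping.single i 1)"
proof (induction f rule: poly_mapping_additive_induct)
  case (single \<nu> c)
  show ?case
  proof (cases "coef \<nu> i = 0")
    case True
    then have "\<nu> \<noteq> \<mu> + Poly_Mapping.single i 1"
      by (auto simp: lookup_add)
    then show ?thesis using True by (simp add: partial_single lookup_single when_def)
  next
    case False
    then have "\<nu> - Poly_Mapping.single i 1 = \<mu> \<longleftrightarrow> \<nu> = \<mu> + Poly_Mapping.single i 1"
      by (auto simp: poly_mapping_eq_iff fun_eq_iff lookup_add lookup_minus lookup_single when_def split: if_splits)
    then show ?thesis
      by (auto simp: partial_single lookup_single when_def lookup_add)
  qed
qed (simp add: partial_add lookup_add algebra_simps)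

text \<open>The Leibniz rule on monomials \<open>x\<^sup>\<mu>\<close>, \<open>x\<^sup>\<nu>\<close>; truncated subtraction of exponents only goes wrong where
  the factor \<open>\<mu>\<^sub>i\<close> or \<open>\<nu>\<^sub>i\<close> vanishes.\<close>

lemma partial_mult: "partial i (f * g) = partial i f * g + f * partial i g"
proof (induction f rule: poly_mapping_additive_induct)
  case (single \<mu> a)
  show ?case
  proof (induction g rule: poly_mapping_additive_induct)
    case (single \<nu> b)
    let ?e = "Poly_Mapping.single i (1::nat)"
    have 1: "Poly_Mapping.single (\<mu> + \<nu> - ?e) (of_nat (coef \<mu> i) * a * b)
        = Poly_Mapping.single (\<mu> - ?e + \<nu>) (of_nat (coef \<mu> i) * a * b)"
    proof (cases "coef \<mu> i = 0")
      case False
      then have "\<mu> + \<nu> - ?e = \<mu> - ?e + \<nu>"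
        by (intro poly_mapping_eqI) (auto simp: lookup_add lookup_minus lookup_single when_def)
      then show ?thesis by simp
    qed simp
    have 2: "Poly_Mapping.single (\<mu> + \<nu> - ?e) (of_nat (coef \<nu> i) * a * b)
        = Poly_Mapping.single (\<mu> + (\<nu> - ?e)) (of_nat (coef \<nu> i) * a * b)"
    proof (cases "coef \<nu> i = 0")
      case False
      then have "\<mu> + \<nu> - ?e = \<mu> + (\<nu> - ?e)"
        by (intro poly_mapping_eqI) (auto simp: lookup_add lookup_minus lookup_single when_def)
      then show ?thesis by simp
    qed simp
    have "partial i (Poly_Mapping.single \<mu> a * Poly_Mapping.single \<nu> b)
        = Poly_Mapping.single (\<mu> + \<nu> - ?e) (of_nat (coef \<mu> i) * a * b)
        + Poly_Mapping.single (\<mu> + \<nu> - ?e) (of_nat (coef \<nu> i) * a * b)"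
      by (simp add: mult_single partial_single lookup_add algebra_simps single_add)
    then show ?case unfolding 1 2 by (simp add: mult_single partial_single algebra_simps)
  qed (simp add: partial_add algebra_simps)
qed (simp add: partial_add algebra_simps)

lemma coef_partial_power:
  "coef ((partial i ^^ k) f) \<mu>
     = pochhammer (of_nat (coef \<mu> i + 1)) k * coef f (\<mu> + Poly_Mapping.single i k)"
proof (induction k arbitrary: \<mu>)
  case (Suc k)
  have "\<mu> + Poly_Mapping.single i 1 + Poly_Mapping.single i k = \<mu> + Poly_Mapping.single i (Suc k)"
    by (simp add: add.assoc single_add[symmetric])
  then show ?case
    by (simp add: coef_partial Suc pochhammer_rec lookup_add algebra_simps)
qed simp

lemma comp_fun_commute_partial_power:
  "comp_fun_commute (\<lambda>i. (partial i ^^ k i) :: ('n, 'k::comm_ring_1) mpoly \<Rightarrow> ('n, 'k) mpoly)"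
proof
  fix i j :: 'n
  show "(partial j ^^ k j) \<circ> (partial i ^^ k i) = ((partial i ^^ k i) \<circ> (partial j ^^ k j)
      :: ('n, 'k) mpoly \<Rightarrow> ('n, 'k) mpoly)"
  proof (cases "i = j")
    case False
    then show ?thesis
      by (auto intro!: ext poly_mapping_eqI simp: coef_partial_power lookup_add lookup_single when_def algebra_simps)
  qed simp
qed

text \<open>Iterated derivatives produce rising factorials in front of shifted coefficients; the claim for an
  arbitrary exponent and an arbitrary set of variables is what the induction along \<open>fold\<close> needs.\<close>

lemma coef_partials_0:
  fixes f :: "('n::finite, 'k::comm_ring_1) mpoly"
  shows "coef (partials \<gamma> f) 0 = of_nat (mfact \<gamma>) * coef f \<gamma>"
proof -
  interpret comp_fun_commute "\<lambda>i. (partial i ^^ coef \<gamma> i) :: ('n, 'k) mpoly \<Rightarrow> ('n, 'k) mpoly"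
    by (rule comp_fun_commute_partial_power)
  have "coef (Finite_Set.fold (\<lambda>i. partial i ^^ coef \<gamma> i) f A) \<mu>
      = (\<Prod>i\<in>A. pochhammer (of_nat (coef \<mu> i + 1)) (coef \<gamma> i))
        * coef f (\<mu> + (\<Sum>i\<in>A. Poly_Mapping.single i (coef \<gamma> i)))" if "finite A" for A \<mu>
    using that
  proof (induction A arbitrary: \<mu>)
    case (insert i A)
    have "(\<Prod>j\<in>A. pochhammer (of_nat (coef (\<mu> + Poly_Mapping.single i (coef \<gamma> i)) j + 1)) (coef \<gamma> j))
        = (\<Prod>j\<in>A. pochhammer (of_nat (coef \<mu> j + 1) :: 'k) (coef \<gamma> j))"
      by (rule prod.cong) (use insert in \<open>auto simp: lookup_add lookup_single when_def\<close>)
    then show ?case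
      using insert by (simp add: coef_partial_power algebra_simps)
  qed simp
  from this[of UNIV 0]
  have "coef (partials \<gamma> f) 0
      = (\<Prod>i\<in>UNIV. pochhammer 1 (coef \<gamma> i)) * coef f (\<Sum>i\<in>UNIV. Poly_Mapping.single i (coef \<gamma> i))"
    by (simp add: partials_def)
  moreover have "pochhammer 1 k = (of_nat (fact k) :: 'k)" for k
    using pochhammer_of_nat[of 1 k, where 'a = 'k] pochhammer_fact[of k, where 'a = nat] by simp
  moreover have "(\<Sum>i\<in>UNIV. Poly_Mapping.single i (coef \<gamma> i)) = \<gamma>"
    by (subst (2) poly_mapping_sum_singles) (rule sum.mono_neutral_right, auto simp: in_keys_iff)
  ultimately show ?thesis by (simp add: mfact_def)
qed

text \<open>The substitution \<open>f(x) \<mapsto> f(x + d)\<close>: the outer polynomial variables are the \<open>d\<^sub>i\<close>, and the coefficients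
  are polynomials in the \<open>x\<^sub>i\<close>.\<close>

definition taylor :: "('n::finite, 'k::comm_ring_1) mpoly \<Rightarrow> ('n, ('n, 'k) mpoly) mpoly"
  where "taylor = meval (\<lambda>c. const (const c)) (\<lambda>i. const (var i) + var i)"

lemma taylor_hom: "unital_hom taylor"
  and taylor_const: "taylor (const c) = const (const c)"
  and taylor_var: "taylor (var i) = const (var i) + var i"
  using meval_hom[OF unital_hom_comp[OF unital_hom_const unital_hom_const]]
  by (simp_all add: taylor_def)

lemmas taylor_simps = unital_homD[OF taylor_hom]

lemma coef_taylor_0: "coef (taylor f) 0 = f"
proof (induction f rule: mpoly_induct)
  case (var i)
  have "Poly_Mapping.single i (1::nat) \<noteq> 0" by (metis lookup_single_eq lookup_zero one_neq_zero)
  then have "coef (var i :: ('a, ('a, 'b) mpoly) mpoly) 0 = 0" by (simp add: var_def lookup_single when_def)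
  then show ?case by (simp add: taylor_var lookup_add)
qed (simp_all add: taylor_const taylor_simps lookup_add coef_mult_0)

text \<open>Differentiating \<open>f(x + d)\<close> with respect to \<open>d\<^sub>i\<close> or to \<open>x\<^sub>i\<close> gives the same. Both sides are
  derivations along \<open>taylor\<close>, so it suffices to look at generators.\<close>

lemma partial_taylor: "partial i (taylor f) = taylor (partial i f)"
proof (induction f rule: mpoly_induct)
  case (const c)
  then show ?case by (simp add: taylor_const partial_single taylor_simps)
next
  case (var j)
  have var: "partial i (var j) = (if i = j then 1 else 0)"
    by (auto simp: var_def partial_single lookup_single when_def)
  \<comment> \<open>The same rule is needed in both polynomial rings, in \<open>x\<close> and in \<open>d\<close>.\<close>
  have var': "partial i (var j) = (if i = j then 1 else 0)"
    by (auto simp: var_def partial_single lookup_single when_def)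
  show ?case by (simp add: taylor_var partial_add var var' partial_single taylor_simps)
qed (simp_all add: partial_add partial_mult taylor_simps)

lemma partials_taylor: "partials \<gamma> (taylor f) = taylor (partials \<gamma> f)"
  for f :: "('n::finite, 'k::comm_ring_1) mpoly"
proof -
  interpret comp_fun_commute "\<lambda>i. (partial i ^^ coef \<gamma> i) :: ('n, 'k) mpoly \<Rightarrow> ('n, 'k) mpoly"
    by (rule comp_fun_commute_partial_power)
  interpret P: comp_fun_commute "\<lambda>i. (partial i ^^ coef \<gamma> i) :: ('n, ('n, 'k) mpoly) mpoly \<Rightarrow> _"
    by (rule comp_fun_commute_partial_power)
  have pow: "(partial i ^^ k) (taylor g) = taylor ((partial i ^^ k) g)" for i k and g :: "('n, 'k) mpoly"
    by (induction k) (simp_all add: partial_taylor)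
  have "Finite_Set.fold (\<lambda>i. partial i ^^ coef \<gamma> i) (taylor f) A
      = taylor (Finite_Set.fold (\<lambda>i. partial i ^^ coef \<gamma> i) f A)" if "finite A" for A
    using that by (induction A) (simp_all add: pow)
  then show ?thesis by (simp add: partials_def)
qed

text \<open>Apply \<open>\<partial>\<^sup>\<gamma>\<close> with respect to \<open>d\<close> to \<open>f(x + d)\<close> and put \<open>d = 0\<close>: the result is \<open>\<gamma>!\<close> times the
  coefficient on the one hand, and \<open>\<partial>\<^sup>\<gamma> f\<close> on the other.\<close>

lemma taylor_coefficient:
  fixes f :: "('n::finite, 'k::field_char_0) mpoly"
  shows "mscale (1 / of_nat (mfact \<gamma>)) (partials \<gamma> f) = coef (taylor f) \<gamma>"
proof -
  have "partials \<gamma> f = of_nat (mfact \<gamma>) * coef (taylor f) \<gamma>"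
    using coef_partials_0[of \<gamma> "taylor f"] by (simp add: partials_taylor coef_taylor_0)
  also have "\<dots> = mscale (of_nat (mfact \<gamma>)) (coef (taylor f) \<gamma>)"
    by (simp add: mscale_def)
  finally have "mscale (1 / of_nat (mfact \<gamma>)) (partials \<gamma> f)
      = mscale (1 / of_nat (mfact \<gamma>) * of_nat (mfact \<gamma>)) (coef (taylor f) \<gamma>)"
    by (simp only: mscale_simps)
  moreover have "mfact \<gamma> \<noteq> 0" by (simp add: mfact_def)
  ultimately show ?thesis by simp
qed

definition jet_exponents :: "nat \<Rightarrow> ('n::finite \<Rightarrow>\<^sub>0 nat) set"
  where "jet_exponents m = {\<alpha>. 1 \<le> msize \<alpha> \<and> msize \<alpha> \<le> m}"

lemma finite_jet_exponents: "finite (jet_exponents m)"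
  by (rule finite_subset[OF _ finite_msize_le[of m]]) (auto simp: jet_exponents_def)

lemma finite_jet_indices: "finite (jet_indices m)"
  by (simp add: jet_indices_def finite_msize_le)

section \<open>The hypersurface algebra and congruence of jets\<close>

definition residue_class :: "('n, 'k::comm_ring_1) mpoly \<Rightarrow> ('n, 'k) mpoly \<Rightarrow> ('n, 'k) mpoly set"
  where "residue_class Q s = {t. Q dvd t - s}"

lemma residue_class_nonempty: "residue_class Q s \<noteq> {}"
proof -
  have "s \<in> residue_class Q s" by (simp add: residue_class_def)
  then show ?thesis by blast
qed

lemma residue_class_eq_iff: "residue_class Q s = residue_class Q t \<longleftrightarrow> Q dvd s - t"
proof
  assume "residue_class Q s = residue_class Q t"
  moreover have "s \<in> residue_class Q s" by (simp add: residue_class_def)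
  ultimately show "Q dvd s - t" by (simp add: residue_class_def)
next
  assume st: "Q dvd s - t"
  have "Q dvd x - s \<longleftrightarrow> Q dvd x - t" for x
    using dvd_add[of Q "x - s" "s - t"] dvd_diff[of Q "x - t" "s - t"] st by auto
  then show "residue_class Q s = residue_class Q t" by (auto simp: residue_class_def)
qed

lemma poly_algebra_simps [simp]:
  "carrier poly_algebra = UNIV" "a \<otimes>\<^bsub>poly_algebra\<^esub> b = a * b" "a \<oplus>\<^bsub>poly_algebra\<^esub> b = a + b"
  "\<one>\<^bsub>poly_algebra\<^esub> = 1" "\<zero>\<^bsub>poly_algebra\<^esub> = 0" "c \<odot>\<^bsub>poly_algebra\<^esub> a = mscale c a"
  by (simp_all add: poly_algebra_def)

lemma PIdl_coset: "(PIdl\<^bsub>poly_algebra\<^esub> Q) +>\<^bsub>poly_algebra\<^esub> s = residue_class Q s"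
proof -
  have "t \<in> (PIdl\<^bsub>poly_algebra\<^esub> Q) +>\<^bsub>poly_algebra\<^esub> s \<longleftrightarrow> (\<exists>u. t = u * Q + s)" for t
    by (auto simp: a_r_coset_def' cgenideal_def)
  also have "\<dots> t \<longleftrightarrow> t \<in> residue_class Q s" for t
    by (auto simp: residue_class_def dvd_def algebra_simps)
  finally show ?thesis by blast
qed

lemma mscale_dvd: "Q dvd s \<Longrightarrow> Q dvd mscale c s"
  by (simp add: mscale_def)

lemma hypersurface_presentation: "ring_presentation (residue_class Q) (hypersurface_algebra Q)"
  and hypersurface_smult: "c \<odot>\<^bsub>hypersurface_algebra Q\<^esub> residue_class Q s = residue_class Q (mscale c s)"
proof -
  let ?R = "hypersurface_algebra Q"
  have carrier: "carrier ?R = range (residue_class Q)"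
    by (auto simp: hypersurface_algebra_def quot_module_def A_RCOSETS_def' PIdl_coset)
  have one: "\<one>\<^bsub>?R\<^esub> = residue_class Q 1"
    by (simp add: hypersurface_algebra_def quot_module_def PIdl_coset)
  have zero: "\<zero>\<^bsub>?R\<^esub> = residue_class Q 0"
    by (auto simp: hypersurface_algebra_def quot_module_def residue_class_def cgenideal_def dvd_def mult.commute)
  have add: "residue_class Q a \<oplus>\<^bsub>?R\<^esub> residue_class Q b = residue_class Q (a + b)" for a b
  proof -
    have "x \<in> residue_class Q a \<oplus>\<^bsub>?R\<^esub> residue_class Q b
        \<longleftrightarrow> (\<exists>y z. Q dvd y - a \<and> Q dvd z - b \<and> x = y + z)" for x
      by (auto simp: hypersurface_algebra_def quot_module_def set_add_def' residue_class_def)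
    also have "\<dots> x \<longleftrightarrow> x \<in> residue_class Q (a + b)" for x
    proof
      assume "\<exists>y z. Q dvd y - a \<and> Q dvd z - b \<and> x = y + z"
      then obtain y z where "Q dvd y - a" "Q dvd z - b" "x = y + z" by blast
      then show "x \<in> residue_class Q (a + b)"
        using dvd_add[of Q "y - a" "z - b"] by (simp add: residue_class_def algebra_simps)
    next
      assume "x \<in> residue_class Q (a + b)"
      then show "\<exists>y z. Q dvd y - a \<and> Q dvd z - b \<and> x = y + z"
        by (intro exI[of _ "x - b"] exI[of _ b]) (simp add: residue_class_def algebra_simps)
    qed
    finally show ?thesis by blast
  qed
  have mult: "residue_class Q a \<otimes>\<^bsub>?R\<^esub> residue_class Q b = residue_class Q (a * b)" for a b
  proof -
    have "residue_class Q (x * y) = residue_class Q (a * b)" if "x \<in> residue_class Q a" "y \<in> residue_class Q b" for x y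
    proof -
      have "x * y - a * b = (x - a) * y + a * (y - b)" by (simp add: algebra_simps)
      then have "Q dvd x * y - a * b" using that by (simp add: residue_class_def)
      then show ?thesis by (simp only: residue_class_eq_iff)
    qed
    then have "(\<Union>x\<in>residue_class Q a. \<Union>y\<in>residue_class Q b. residue_class Q (x * y))
        = (\<Union>x\<in>residue_class Q a. \<Union>y\<in>residue_class Q b. residue_class Q (a * b))"
      by (intro SUP_cong refl)
    then have "(\<Union>x\<in>residue_class Q a. \<Union>y\<in>residue_class Q b. residue_class Q (x * y))
        = residue_class Q (a * b)"
      by (simp only: UN_constant residue_class_nonempty if_False)
    then show ?thesis
      by (simp add: hypersurface_algebra_def quot_module_def rcoset_mult_def PIdl_coset)
  qed
  show "ring_presentation (residue_class Q) ?R"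
    by (simp add: ring_presentation_def carrier one zero add mult)
  have "residue_class Q (mscale c x) = residue_class Q (mscale c s)" if "x \<in> residue_class Q s" for x
  proof -
    have "Q dvd mscale c x - mscale c s"
      using that mscale_dvd[of Q "x - s" c] by (simp add: residue_class_def)
    then show ?thesis by (simp only: residue_class_eq_iff)
  qed
  then have "(\<Union>x\<in>residue_class Q s. residue_class Q (mscale c x))
      = (\<Union>x\<in>residue_class Q s. residue_class Q (mscale c s))"
    by (intro SUP_cong refl)
  then have "(\<Union>x\<in>residue_class Q s. residue_class Q (mscale c x)) = residue_class Q (mscale c s)"
    by (simp only: UN_constant residue_class_nonempty if_False)
  then show "c \<odot>\<^bsub>?R\<^esub> residue_class Q s = residue_class Q (mscale c s)"
    by (simp add: hypersurface_algebra_def quot_module_def PIdl_coset)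
qed

locale hypersurface =
  fixes Q :: "('n::finite, 'k::comm_ring_1) mpoly"
begin

abbreviation \<pi> :: "('n, 'k) mpoly \<Rightarrow> ('n, 'k) mpoly set" where "\<pi> \<equiv> residue_class Q"

abbreviation R :: "('k, ('n, 'k) mpoly set) module" where "R \<equiv> hypersurface_algebra Q"

abbreviation KK :: "'k ring" where "KK \<equiv> ring_of_type_algebra"

lemmas R_simps = ring_presentationD[OF hypersurface_presentation[of Q]]

definition lift :: "('n, 'k) mpoly set \<Rightarrow> ('n, 'k) mpoly"
  where "lift = inv_into UNIV \<pi>"

lemma residue_class_lift: "a \<in> range \<pi> \<Longrightarrow> \<pi> (lift a) = a"
  by (simp add: lift_def f_inv_into_f)

text \<open>The ideal generated by \<open>Q(x)\<close> and \<open>Q(x + d)\<close>.\<close>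

definition jet_relations :: "('n, ('n, 'k) mpoly) mpoly set"
  where "jet_relations = {const Q * u + taylor Q * w | u w. True}"

lemma jet_relations_closed:
  "0 \<in> jet_relations"
  "f \<in> jet_relations \<Longrightarrow> g \<in> jet_relations \<Longrightarrow> f + g \<in> jet_relations"
  "f \<in> jet_relations \<Longrightarrow> h * f \<in> jet_relations"
  "f \<in> jet_relations \<Longrightarrow> - f \<in> jet_relations"
  "f \<in> jet_relations \<Longrightarrow> g \<in> jet_relations \<Longrightarrow> f - g \<in> jet_relations"
proof -
  have I: "const Q * u + taylor Q * w \<in> jet_relations" for u w
    by (auto simp: jet_relations_def)
  show "0 \<in> jet_relations" using I[of 0 0] by simp
  show add: "f + g \<in> jet_relations" if fg: "f \<in> jet_relations" "g \<in> jet_relations" for f g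
  proof -
    obtain u w u' w' where "f = const Q * u + taylor Q * w" "g = const Q * u' + taylor Q * w'"
      using fg unfolding jet_relations_def by blast
    then have "f + g = const Q * (u + u') + taylor Q * (w + w')" by (simp add: algebra_simps)
    then show ?thesis using I by simp
  qed
  show mult: "h * f \<in> jet_relations" if f: "f \<in> jet_relations" for f h
  proof -
    obtain u w where "f = const Q * u + taylor Q * w" using f unfolding jet_relations_def by blast
    then have "h * f = const Q * (h * u) + taylor Q * (h * w)" by (simp add: algebra_simps)
    then show ?thesis using I by simp
  qed
  show minus: "- f \<in> jet_relations" if "f \<in> jet_relations" for f
    using mult[OF that, of "- 1"] by simp
  show "f - g \<in> jet_relations" if "f \<in> jet_relations" "g \<in> jet_relations" for f g
    using add[OF that(1) minus[OF that(2)]] by simp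
qed

definition jet_cong :: "('n, ('n, 'k) mpoly) mpoly \<Rightarrow> ('n, ('n, 'k) mpoly) mpoly \<Rightarrow> bool"  (infix "\<doteq>" 50)
  where "f \<doteq> g \<longleftrightarrow> f - g \<in> jet_relations"

lemma jet_cong_refl [simp]: "f \<doteq> f"
  by (simp add: jet_cong_def jet_relations_closed)

lemma jet_cong_sym: "f \<doteq> g \<Longrightarrow> g \<doteq> f"
  using jet_relations_closed(4)[of "f - g"] by (simp add: jet_cong_def)

lemma jet_cong_trans [trans]: "f \<doteq> g \<Longrightarrow> g \<doteq> h \<Longrightarrow> f \<doteq> h"
  using jet_relations_closed(2)[of "f - g" "g - h"] by (simp add: jet_cong_def)

lemma jet_cong_add: "f \<doteq> f' \<Longrightarrow> g \<doteq> g' \<Longrightarrow> f + g \<doteq> f' + g'"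
  using jet_relations_closed(2)[of "f - f'" "g - g'"] by (simp add: jet_cong_def algebra_simps)

lemma jet_cong_diff: "f \<doteq> f' \<Longrightarrow> g \<doteq> g' \<Longrightarrow> f - g \<doteq> f' - g'"
  using jet_relations_closed(5)[of "f - f'" "g - g'"] by (simp add: jet_cong_def algebra_simps)

lemma jet_cong_mult: "f \<doteq> f' \<Longrightarrow> g \<doteq> g' \<Longrightarrow> f * g \<doteq> f' * g'"
  using jet_relations_closed(2)[OF jet_relations_closed(3)[of "g - g'" f] jet_relations_closed(3)[of "f - f'" g']]
  by (simp add: jet_cong_def algebra_simps)

lemma jet_cong_lift: "const (lift (\<pi> s)) \<doteq> const s" "taylor (lift (\<pi> s)) \<doteq> taylor s"
proof -
  have "\<pi> (lift (\<pi> s)) = \<pi> s" by (rule residue_class_lift) simp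
  then have "Q dvd lift (\<pi> s) - s" by (simp only: residue_class_eq_iff)
  then obtain t where t: "lift (\<pi> s) = s + Q * t" by (auto simp: dvd_def algebra_simps)
  have "const (lift (\<pi> s)) - const s = const Q * const t + taylor Q * 0"
    by (simp add: t single_add mult_single)
  then show "const (lift (\<pi> s)) \<doteq> const s" unfolding jet_cong_def jet_relations_def by blast
  have "taylor (lift (\<pi> s)) - taylor s = const Q * 0 + taylor Q * taylor t"
    by (simp add: t taylor_simps)
  then show "taylor (lift (\<pi> s)) \<doteq> taylor s" unfolding jet_cong_def jet_relations_def by blast
qed

text \<open>The element \<open>a(x) b(x + d)\<close>. Representatives are chosen once and for all, so that the map is defined on
  all pairs and its additive extension is exact; independence of the choice holds modulo
  \<open>jet_relations\<close>.\<close>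

definition pair_jet :: "('n, 'k) mpoly set \<times> ('n, 'k) mpoly set \<Rightarrow> ('n, ('n, 'k) mpoly) mpoly"
  where "pair_jet k = const (lift (fst k)) * taylor (lift (snd k))"

lemma pair_jet: "pair_jet (\<pi> s, \<pi> t) \<doteq> const s * taylor t"
  unfolding pair_jet_def by (simp add: jet_cong_mult jet_cong_lift)

definition to_jet :: "(('n, 'k) mpoly set \<times> ('n, 'k) mpoly set \<Rightarrow>\<^sub>0 int) \<Rightarrow> ('n, ('n, 'k) mpoly) mpoly"
  where "to_jet x = (\<Sum>k\<in>Poly_Mapping.keys x. of_int (coef x k) * pair_jet k)"

lemma to_jet_add: "to_jet (x + y) = to_jet x + to_jet y"
  unfolding to_jet_def by (rule setsum_keys_plus_distrib) (simp_all add: algebra_simps)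

lemma to_jet_simps [simp]: "to_jet 0 = 0" "to_jet (frag_of k) = pair_jet k"
  by (simp_all add: to_jet_def)

lemma to_jet_diff: "to_jet (x - y) = to_jet x - to_jet y"
  using to_jet_add[of "x - y" y] by simp

lemma to_jet_minus: "to_jet (- x) = - to_jet x"
  using to_jet_diff[of 0 x] by simp

section \<open>The tensor square as a quotient of the polynomials in x and d\<close>

abbreviation pairs where "pairs \<equiv> {x. Poly_Mapping.keys x \<subseteq> range \<pi> \<times> range \<pi>}"

lemma pairs_closed:
  "0 \<in> pairs" "frag_of (\<pi> s, \<pi> t) \<in> pairs" "x \<in> pairs \<Longrightarrow> y \<in> pairs \<Longrightarrow> x + y \<in> pairs"
  "x \<in> pairs \<Longrightarrow> y \<in> pairs \<Longrightarrow> x - y \<in> pairs"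
  using keys_add[of x y] keys_diff[of x y] by auto

lemma pairs_induct [consumes 1, case_names zero tensor diff]:
  assumes "x \<in> pairs" and "P 0" and "\<And>s t. P (frag_of (\<pi> s, \<pi> t))"
    and "\<And>x y. P x \<Longrightarrow> P y \<Longrightarrow> P (x - y)"
  shows "P x"
proof (rule frag_induction[of x "range \<pi> \<times> range \<pi>" P])
  show "P (frag_of k)" if "k \<in> range \<pi> \<times> range \<pi>" for k
    using that assms(3) by auto
qed (use assms in auto)

abbreviation \<K> where "\<K> \<equiv> tensor_kernel KK R R"

text \<open>Elements of \<open>R\<close> are replaced by representatives in \<open>S\<close> here, so that what follows only has to compute with
  polynomials.\<close>

lemma tensor_relations_cases [consumes 1, case_names left right balanced]:
  assumes "h \<in> tensor_relations KK R R"
  obtains s s' t where "h = frag_of (\<pi> (s + s'), \<pi> t) - frag_of (\<pi> s, \<pi> t) - frag_of (\<pi> s', \<pi> t)"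
  | s t t' where "h = frag_of (\<pi> s, \<pi> (t + t')) - frag_of (\<pi> s, \<pi> t) - frag_of (\<pi> s, \<pi> t')"
  | c s t where "h = frag_of (\<pi> (mscale c s), \<pi> t) - frag_of (\<pi> s, \<pi> (mscale c t))"
proof -
  from assms consider
      (1) a a' b where "h = frag_of (a \<oplus>\<^bsub>R\<^esub> a', b) - frag_of (a, b) - frag_of (a', b)"
        "a \<in> range \<pi>" "a' \<in> range \<pi>" "b \<in> range \<pi>"
    | (2) a b b' where "h = frag_of (a, b \<oplus>\<^bsub>R\<^esub> b') - frag_of (a, b) - frag_of (a, b')"
        "a \<in> range \<pi>" "b \<in> range \<pi>" "b' \<in> range \<pi>"
    | (3) c a b where "h = frag_of (c \<odot>\<^bsub>R\<^esub> a, b) - frag_of (a, c \<odot>\<^bsub>R\<^esub> b)"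
        "a \<in> range \<pi>" "b \<in> range \<pi>"
    unfolding tensor_relations_def R_simps(1) by blast
  then show ?thesis
  proof cases
    case 1
    then obtain s s' t where "a = \<pi> s" "a' = \<pi> s'" "b = \<pi> t" by auto
    then show ?thesis using 1(1) that(1) by (simp only: R_simps(4))
  next
    case 2
    then obtain s t t' where "a = \<pi> s" "b = \<pi> t" "b' = \<pi> t'" by auto
    then show ?thesis using 2(1) that(2) by (simp only: R_simps(4))
  next
    case 3
    then obtain s t where "a = \<pi> s" "b = \<pi> t" by auto
    then show ?thesis using 3(1) that(3) by (simp only: hypersurface_smult)
  qed
qed

lemma subgroup_\<K>: "subgroup \<K> (free_Abelian_group (range \<pi> \<times> range \<pi>))"
proof -
  have "tensor_relations KK R R \<subseteq> pairs"
  proof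
    fix h assume "h \<in> tensor_relations KK R R"
    then show "h \<in> pairs"
    proof (cases rule: tensor_relations_cases)
      case (left s s' t)
      show ?thesis unfolding left by (intro pairs_closed(2,4))
    next
      case (right s t t')
      show ?thesis unfolding right by (intro pairs_closed(2,4))
    next
      case (balanced c s t)
      show ?thesis unfolding balanced by (intro pairs_closed(2,4))
    qed
  qed
  then show ?thesis
    unfolding tensor_kernel_def R_simps(1)
    by (intro group.generate_is_subgroup group_free_Abelian_group) (auto simp: free_Abelian_group_def)
qed

lemma \<K>_closed:
  "0 \<in> \<K>" "x \<in> \<K> \<Longrightarrow> y \<in> \<K> \<Longrightarrow> x + y \<in> \<K>" "x \<in> \<K> \<Longrightarrow> x \<in> pairs" "x \<in> \<K> \<Longrightarrow> - x \<in> \<K>"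
  "x \<in> \<K> \<Longrightarrow> y \<in> \<K> \<Longrightarrow> x - y \<in> \<K>"
proof -
  interpret subgroup \<K> "free_Abelian_group (range \<pi> \<times> range \<pi>)" by (rule subgroup_\<K>)
  show "0 \<in> \<K>" using one_closed by simp
  show add: "x + y \<in> \<K>" if "x \<in> \<K>" "y \<in> \<K>" for x y using m_closed[OF that] by simp
  show pairs: "x \<in> pairs" if "x \<in> \<K>" for x using mem_carrier[OF that] by simp
  show minus: "- x \<in> \<K>" if "x \<in> \<K>" for x using m_inv_closed[OF that] pairs[OF that] by simp
  show "x - y \<in> \<K>" if "x \<in> \<K>" "y \<in> \<K>" for x y using add[OF that(1) minus[OF that(2)]] by simp
qed

lemma \<K>_relations:
  "frag_of (\<pi> (s + s'), \<pi> t) - frag_of (\<pi> s, \<pi> t) - frag_of (\<pi> s', \<pi> t) \<in> \<K>"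
  "frag_of (\<pi> s, \<pi> (t + t')) - frag_of (\<pi> s, \<pi> t) - frag_of (\<pi> s, \<pi> t') \<in> \<K>"
  "frag_of (\<pi> (mscale c s), \<pi> t) - frag_of (\<pi> s, \<pi> (mscale c t)) \<in> \<K>"
proof -
  have K: "carrier KK = UNIV" by (simp add: ring_of_type_algebra_def)
  have "frag_of (\<pi> s \<oplus>\<^bsub>R\<^esub> \<pi> s', \<pi> t) - frag_of (\<pi> s, \<pi> t) - frag_of (\<pi> s', \<pi> t) \<in> tensor_relations KK R R"
    unfolding tensor_relations_def R_simps(1)
    by (rule UnI1, rule UnI1, rule CollectI, intro exI conjI, rule refl) simp_all
  then show "frag_of (\<pi> (s + s'), \<pi> t) - frag_of (\<pi> s, \<pi> t) - frag_of (\<pi> s', \<pi> t) \<in> \<K>"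
    unfolding tensor_kernel_def R_simps(4) by (rule generate.incl)
  have "frag_of (\<pi> s, \<pi> t \<oplus>\<^bsub>R\<^esub> \<pi> t') - frag_of (\<pi> s, \<pi> t) - frag_of (\<pi> s, \<pi> t') \<in> tensor_relations KK R R"
    unfolding tensor_relations_def R_simps(1)
    by (rule UnI1, rule UnI2, rule CollectI, intro exI conjI, rule refl) simp_all
  then show "frag_of (\<pi> s, \<pi> (t + t')) - frag_of (\<pi> s, \<pi> t) - frag_of (\<pi> s, \<pi> t') \<in> \<K>"
    unfolding tensor_kernel_def R_simps(4) by (rule generate.incl)
  have "frag_of (c \<odot>\<^bsub>R\<^esub> \<pi> s, \<pi> t) - frag_of (\<pi> s, c \<odot>\<^bsub>R\<^esub> \<pi> t) \<in> tensor_relations KK R R"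
    unfolding tensor_relations_def R_simps(1) K
    by (rule UnI2, rule CollectI, intro exI conjI, rule refl) simp_all
  then show "frag_of (\<pi> (mscale c s), \<pi> t) - frag_of (\<pi> s, \<pi> (mscale c t)) \<in> \<K>"
    unfolding tensor_kernel_def hypersurface_smult by (rule generate.incl)
qed

text \<open>The expression \<open>a(x) b(x + d)\<close> is biadditive and balanced over the constants, which \<open>taylor\<close> fixes.\<close>

lemma to_jet_\<K>:
  assumes "x \<in> \<K>"
  shows "to_jet x \<in> jet_relations"
proof -
  have rel: "to_jet h \<in> jet_relations" "Poly_Mapping.keys h \<subseteq> range \<pi> \<times> range \<pi>" if "h \<in> tensor_relations KK R R" for h
  proof -
    have "to_jet h \<doteq> 0"
      using that
    proof (cases rule: tensor_relations_cases)
      case h: (left s s' t)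
      have "to_jet h \<doteq> const (s + s') * taylor t - const s * taylor t - const s' * taylor t"
        unfolding h to_jet_diff to_jet_simps by (intro jet_cong_diff pair_jet)
      then show ?thesis by (simp add: single_add algebra_simps)
    next
      case h: (right s t t')
      have "to_jet h \<doteq> const s * taylor (t + t') - const s * taylor t - const s * taylor t'"
        unfolding h to_jet_diff to_jet_simps by (intro jet_cong_diff pair_jet)
      then show ?thesis by (simp add: taylor_simps algebra_simps)
    next
      case h: (balanced c s t)
      have "to_jet h \<doteq> const (mscale c s) * taylor t - const s * taylor (mscale c t)"
        unfolding h to_jet_diff to_jet_simps by (intro jet_cong_diff pair_jet)
      also have "const (mscale c s) = const (const c) * const s" by (simp add: mscale_def mult_single)
      also have "taylor (mscale c t) = const (const c) * taylor t"
        by (simp add: mscale_def taylor_simps taylor_const)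
      also have "const (const c) * const s * taylor t - const s * (const (const c) * taylor t) = 0"
        by (simp add: algebra_simps)
      finally show ?thesis .
    qed
    then show "to_jet h \<in> jet_relations" by (simp add: jet_cong_def)
    have "h \<in> \<K>" unfolding tensor_kernel_def by (rule generate.incl[OF that])
    then show "Poly_Mapping.keys h \<subseteq> range \<pi> \<times> range \<pi>" using \<K>_closed(3) by blast
  qed
  show ?thesis
    using assms unfolding tensor_kernel_def R_simps(1)
    by (induction rule: generate.induct) (simp_all add: rel to_jet_add to_jet_minus jet_relations_closed)
qed

text \<open>The inverse of \<open>y\<^sub>i \<mapsto> x\<^sub>i + d\<^sub>i\<close>: it rewrites a polynomial in \<open>x\<close> and \<open>d\<close> in the coordinates \<open>x\<close> and
  \<open>y = x + d\<close>. In these, \<open>f(x + d)\<close> becomes \<open>f(y)\<close>, which is \<open>coefficients f\<close>.\<close>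

definition coordinate_change :: "('n, ('n, 'k) mpoly) mpoly \<Rightarrow> ('n, ('n, 'k) mpoly) mpoly"
  where "coordinate_change = meval const (\<lambda>i. var i - const (var i))"

definition coefficients :: "('n, 'k) mpoly \<Rightarrow> ('n, ('n, 'k) mpoly) mpoly"
  where "coefficients = meval (\<lambda>c. const (const c)) var"

lemma coordinate_change_hom: "unital_hom coordinate_change"
  and coordinate_change_const: "coordinate_change (const s) = const s"
  and coordinate_change_var: "coordinate_change (var i) = var i - const (var i)"
  using meval_hom[OF unital_hom_const] by (simp_all add: coordinate_change_def)

lemma coefficients_hom: "unital_hom coefficients"
  and coefficients_const: "coefficients (const c) = const (const c)"
  and coefficients_var: "coefficients (var i) = var i"
  using meval_hom[OF unital_hom_comp[OF unital_hom_const unital_hom_const]]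
  by (simp_all add: coefficients_def)

lemma coefficients_single: "coefficients (Poly_Mapping.single \<mu> c) = Poly_Mapping.single \<mu> (const c)"
  unfolding coefficients_def meval_hom(4)[OF unital_hom_comp[OF unital_hom_const unital_hom_const]]
  by (simp add: prod_var_power mult_single)

lemma coordinate_change_taylor: "coordinate_change (taylor s) = coefficients s"
  by (induction s rule: mpoly_induct)
    (simp_all add: taylor_const taylor_var coefficients_const coefficients_var coordinate_change_const
      coordinate_change_var taylor_simps unital_homD[OF coordinate_change_hom] unital_homD[OF coefficients_hom])

text \<open>The formal sum \<open>\<Sum>\<^sub>\<mu> g\<^sub>\<mu> \<otimes> y\<^sup>\<mu>\<close>. It is additive only modulo the tensor relations, since \<open>frag_of\<close> is not
  additive in the pair.\<close>

definition normal_form :: "('n, ('n, 'k) mpoly) mpoly \<Rightarrow> ('n, 'k) mpoly set \<times> ('n, 'k) mpoly set \<Rightarrow>\<^sub>0 int"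
  where "normal_form g = (\<Sum>\<mu>\<in>Poly_Mapping.keys g. frag_of (\<pi> (coef g \<mu>), \<pi> (Poly_Mapping.single \<mu> 1)))"

lemma \<K>_trans: "x - y \<in> \<K> \<Longrightarrow> y - z \<in> \<K> \<Longrightarrow> x - z \<in> \<K>"
  using \<K>_closed(2)[of "x - y" "y - z"] by simp

lemma \<K>_sym: "x - y \<in> \<K> \<Longrightarrow> y - x \<in> \<K>"
  using \<K>_closed(4)[of "x - y"] by simp

lemma \<K>_diffD: "x - y \<in> \<K> \<Longrightarrow> y \<in> \<K> \<Longrightarrow> x \<in> \<K>"
  using \<K>_closed(2)[of "x - y" y] by simp

lemma \<K>_zero: "frag_of (\<pi> 0, \<pi> t) \<in> \<K>" "frag_of (\<pi> s, \<pi> 0) \<in> \<K>"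
  using \<K>_relations(1)[of 0 0 t, THEN \<K>_closed(4)] \<K>_relations(2)[of s 0 0, THEN \<K>_closed(4)] by simp_all

lemma \<K>_sum: "(\<And>i. i \<in> I \<Longrightarrow> h i \<in> \<K>) \<Longrightarrow> sum h I \<in> \<K>"
  by (induction I rule: infinite_finite_induct) (auto intro: \<K>_closed)

text \<open>Summing over more exponents than occur adds terms \<open>0 \<otimes> y\<^sup>\<mu>\<close>, which are tensor relations up to sign. This
  allows a common range of summation for two polynomials and their sum.\<close>

lemma normal_form_superset:
  assumes "finite U" "Poly_Mapping.keys g \<subseteq> U"
  shows "(\<Sum>\<mu>\<in>U. frag_of (\<pi> (coef g \<mu>), \<pi> (Poly_Mapping.single \<mu> 1))) - normal_form g \<in> \<K>"
proof -
  have "(\<Sum>\<mu>\<in>U. frag_of (\<pi> (coef g \<mu>), \<pi> (Poly_Mapping.single \<mu> 1))) - normal_form g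
      = (\<Sum>\<mu>\<in>U - Poly_Mapping.keys g. frag_of (\<pi> (coef g \<mu>), \<pi> (Poly_Mapping.single \<mu> 1)))"
    unfolding normal_form_def using assms by (simp add: sum_diff)
  moreover have "\<dots> \<in> \<K>"
    by (rule \<K>_sum) (auto simp: in_keys_iff \<K>_zero)
  ultimately show ?thesis by simp
qed

lemma normal_form_single: "normal_form (Poly_Mapping.single \<mu> s) - frag_of (\<pi> s, \<pi> (Poly_Mapping.single \<mu> 1)) \<in> \<K>"
  using normal_form_superset[of "{\<mu>}" "Poly_Mapping.single \<mu> s"] \<K>_sym by simp

lemma normal_form_add: "normal_form (f + g) - (normal_form f + normal_form g) \<in> \<K>"
proof -
  define U where "U = Poly_Mapping.keys f \<union> Poly_Mapping.keys g"
  define F where "F h = (\<Sum>\<mu>\<in>U. frag_of (\<pi> (coef h \<mu>), \<pi> (Poly_Mapping.single \<mu> 1)))"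
    for h :: "('n, ('n, 'k) mpoly) mpoly"
  have U: "finite U" "Poly_Mapping.keys f \<subseteq> U" "Poly_Mapping.keys g \<subseteq> U" "Poly_Mapping.keys (f + g) \<subseteq> U"
    using keys_add[of f g] by (auto simp: U_def)
  have F: "F f - normal_form f \<in> \<K>" "F g - normal_form g \<in> \<K>" "F (f + g) - normal_form (f + g) \<in> \<K>"
    unfolding F_def using normal_form_superset U by blast+
  have F_add: "F (f + g) - F f - F g \<in> \<K>"
    unfolding F_def sum_subtractf[symmetric] lookup_add by (rule \<K>_sum) (rule \<K>_relations(1))
  have "F (f + g) - F f - F g + (F f - normal_form f) + (F g - normal_form g) - (F (f + g) - normal_form (f + g)) \<in> \<K>"
    by (rule \<K>_closed(5)[OF \<K>_closed(2)[OF \<K>_closed(2)[OF F_add F(1)] F(2)] F(3)])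
  then show ?thesis by (simp add: algebra_simps)
qed

lemma normal_form_0: "normal_form 0 = 0"
  by (simp add: normal_form_def)

lemma normal_form_diff: "normal_form (f - g) - (normal_form f - normal_form g) \<in> \<K>"
  using \<K>_sym[OF normal_form_add[of "f - g" g]] \<K>_sym by (simp add: algebra_simps)

text \<open>Moving the constants of \<open>t\<close> across the tensor sign turns \<open>s(x) t(y) y\<^sup>\<nu>\<close> into \<open>s \<otimes> t x\<^sup>\<nu>\<close>. The factor
  \<open>y\<^sup>\<nu>\<close> makes the lemma applicable to all multiples of \<open>Q(y)\<close>.\<close>

lemma normal_form_tensor:
  "normal_form (const s * coefficients t * Poly_Mapping.single \<nu> 1) - frag_of (\<pi> s, \<pi> (t * Poly_Mapping.single \<nu> 1)) \<in> \<K>"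
proof (induction t rule: poly_mapping_additive_induct)
  case (single \<mu> c)
  have 1: "const s * coefficients (Poly_Mapping.single \<mu> c) * Poly_Mapping.single \<nu> 1
      = Poly_Mapping.single (\<mu> + \<nu>) (mscale c s)"
    by (simp add: coefficients_single mult_single mscale_def mult.commute add.commute[of \<mu> \<nu>])
  have 2: "mscale c (Poly_Mapping.single (\<mu> + \<nu>) 1) = Poly_Mapping.single \<mu> c * Poly_Mapping.single \<nu> 1"
    by (simp add: mult_single mscale_def)
  show ?case
    unfolding 1 2[symmetric] by (rule \<K>_trans[OF normal_form_single \<K>_relations(3)])
next
  case (add t t')
  let ?a = "\<lambda>t. const s * coefficients t * Poly_Mapping.single \<nu> 1"
  let ?b = "\<lambda>t. t * Poly_Mapping.single \<nu> 1"
  have a: "?a (t + t') = ?a t + ?a t'" by (simp add: unital_homD[OF coefficients_hom] algebra_simps)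
  have b: "?b (t + t') = ?b t + ?b t'" by (simp add: algebra_simps)
  have "(normal_form (?a t + ?a t') - (normal_form (?a t) + normal_form (?a t'))) + (normal_form (?a t) - frag_of (\<pi> s, \<pi> (?b t)))
      + (normal_form (?a t') - frag_of (\<pi> s, \<pi> (?b t')))
      - (frag_of (\<pi> s, \<pi> (?b t + ?b t')) - frag_of (\<pi> s, \<pi> (?b t)) - frag_of (\<pi> s, \<pi> (?b t'))) \<in> \<K>"
    by (rule \<K>_closed(5)[OF \<K>_closed(2)[OF \<K>_closed(2)[OF normal_form_add add(1)] add(2)] \<K>_relations(2)])
  then show ?case unfolding a b by (simp add: algebra_simps)
qed

lemma normal_form_relations: "normal_form (const Q * u) \<in> \<K>" "normal_form (coefficients Q * w) \<in> \<K>"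
proof -
  have pi_mult: "\<pi> (Q * s) = \<pi> 0" for s
    by (simp add: residue_class_eq_iff)
  show "normal_form (const Q * u) \<in> \<K>"
  proof (induction u rule: poly_mapping_additive_induct)
    case (single \<mu> s)
    have "normal_form (Poly_Mapping.single \<mu> (Q * s)) - frag_of (\<pi> 0, \<pi> (Poly_Mapping.single \<mu> 1)) \<in> \<K>"
      using normal_form_single[of \<mu> "Q * s"] by (simp only: pi_mult)
    from \<K>_diffD[OF this \<K>_zero(1)] show ?case by (simp add: mult_single)
  next
    case (add f g)
    then show ?case
      using \<K>_diffD[OF normal_form_add \<K>_closed(2)[OF add]] by (simp add: algebra_simps)
  qed
  show "normal_form (coefficients Q * w) \<in> \<K>"
  proof (induction w rule: poly_mapping_additive_induct)
    case (single \<nu> s)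
    have "const s * coefficients Q * Poly_Mapping.single \<nu> 1 = coefficients Q * Poly_Mapping.single \<nu> s"
      by (simp add: mult_single mult.assoc mult.left_commute)
    then have "normal_form (coefficients Q * Poly_Mapping.single \<nu> s) - frag_of (\<pi> s, \<pi> 0) \<in> \<K>"
      using normal_form_tensor[of s Q \<nu>] by (simp only: pi_mult)
    from \<K>_diffD[OF this \<K>_zero(2)] show ?case by simp
  next
    case (add f g)
    then show ?case
      using \<K>_diffD[OF normal_form_add \<K>_closed(2)[OF add]] by (simp add: algebra_simps)
  qed
qed

lemma normal_form_to_jet:
  assumes "x \<in> pairs"
  shows "normal_form (coordinate_change (to_jet x)) - x \<in> \<K>"
  using assms
proof (induction x rule: pairs_induct)
  case zero
  then show ?case by (simp add: unital_homD[OF coordinate_change_hom] normal_form_0 \<K>_closed)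
next
  case (tensor s t)
  have lift: "\<pi> (lift (\<pi> s)) = \<pi> s" for s by (rule residue_class_lift) simp
  have "coordinate_change (to_jet (frag_of (\<pi> s, \<pi> t)))
      = const (lift (\<pi> s)) * coefficients (lift (\<pi> t)) * Poly_Mapping.single 0 1"
    by (simp add: pair_jet_def unital_homD[OF coordinate_change_hom] coordinate_change_const coordinate_change_taylor)
  then show ?case
    using normal_form_tensor[of "lift (\<pi> s)" "lift (\<pi> t)" 0] by (simp add: lift)
next
  case (diff x y)
  have "(normal_form (coordinate_change (to_jet (x - y))) - (normal_form (coordinate_change (to_jet x)) - normal_form (coordinate_change (to_jet y))))
      + (normal_form (coordinate_change (to_jet x)) - x) - (normal_form (coordinate_change (to_jet y)) - y) \<in> \<K>"
    unfolding to_jet_diff unital_homD(5)[OF coordinate_change_hom]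
    by (rule \<K>_closed(5)[OF \<K>_closed(2)[OF normal_form_diff diff(1)] diff(2)])
  then show ?case by (simp add: algebra_simps)
qed

text \<open>The map from the tensor product to the jets is injective: the normal form recovers a formal sum from
  its image up to tensor relations, and it kills the ideal \<open>jet_relations\<close>.\<close>

lemma to_jet_in_jet_relations_iff:
  assumes "x \<in> pairs"
  shows "to_jet x \<in> jet_relations \<longleftrightarrow> x \<in> \<K>"
proof
  assume "to_jet x \<in> jet_relations"
  then obtain u w where uw: "to_jet x = const Q * u + taylor Q * w" unfolding jet_relations_def by blast
  \<comment> \<open>In the coordinates \<open>x\<close>, \<open>y\<close> the two relations are \<open>Q(x)\<close> and \<open>Q(y)\<close>.\<close>
  let ?f = "const Q * coordinate_change u" and ?g = "coefficients Q * coordinate_change w"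
  have eq: "coordinate_change (to_jet x) = ?f + ?g"
    by (simp add: uw unital_homD[OF coordinate_change_hom] coordinate_change_const coordinate_change_taylor)
  have "normal_form (?f + ?g) - (normal_form ?f + normal_form ?g) + (normal_form ?f + normal_form ?g) - (normal_form (coordinate_change (to_jet x)) - x) \<in> \<K>"
    by (rule \<K>_closed(5)[OF \<K>_closed(2)[OF normal_form_add \<K>_closed(2)[OF normal_form_relations]] normal_form_to_jet[OF assms]])
  then show "x \<in> \<K>" by (simp add: eq)
qed (rule to_jet_\<K>)

abbreviation pair_RR where "pair_RR \<equiv> pair_ring R R"

lemma pair_RR_simps:
  "carrier pair_RR = pairs" "x \<oplus>\<^bsub>pair_RR\<^esub> y = x + y" "\<one>\<^bsub>pair_RR\<^esub> = frag_of (\<pi> 1, \<pi> 1)"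
  by (simp_all add: pair_ring_def R_simps free_Abelian_group_def)

lemma pair_RR_mult:
  assumes "x \<in> pairs" "y \<in> pairs"
  shows "x \<otimes>\<^bsub>pair_RR\<^esub> y \<in> pairs \<and> to_jet (x \<otimes>\<^bsub>pair_RR\<^esub> y) \<doteq> to_jet x * to_jet y"
proof -
  define G where "G k = frag_extend (\<lambda>(a', b'). frag_of (fst k \<otimes>\<^bsub>R\<^esub> a', snd k \<otimes>\<^bsub>R\<^esub> b'))" for k
  have mult: "x \<otimes>\<^bsub>pair_RR\<^esub> y = frag_extend (\<lambda>k. G k y) x" for x y
    by (simp add: pair_ring_def G_def case_prod_unfold)
  have mult_tensor: "G (\<pi> s, \<pi> t) y \<in> pairs \<and> to_jet (G (\<pi> s, \<pi> t) y) \<doteq> pair_jet (\<pi> s, \<pi> t) * to_jet y"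
    if "y \<in> pairs" for s t y
    using that
  proof (induction y rule: pairs_induct)
    case zero
    show ?case by (simp add: G_def)
  next
    case (tensor s' t')
    have G: "G (\<pi> s, \<pi> t) (frag_of (\<pi> s', \<pi> t')) = frag_of (\<pi> (s * s'), \<pi> (t * t'))"
      by (simp add: G_def R_simps)
    have "pair_jet (\<pi> (s * s'), \<pi> (t * t')) \<doteq> const (s * s') * taylor (t * t')"
      by (rule pair_jet)
    also have "const (s * s') * taylor (t * t') = (const s * taylor t) * (const s' * taylor t')"
      by (simp add: unital_homD(3)[OF unital_hom_const] taylor_simps mult.assoc mult.left_commute)
    also have "\<dots> \<doteq> pair_jet (\<pi> s, \<pi> t) * pair_jet (\<pi> s', \<pi> t')"
      by (intro jet_cong_mult jet_cong_sym[OF pair_jet])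
    finally show ?case unfolding G to_jet_simps using pairs_closed(2) by blast
  next
    case (diff x y)
    have "G (\<pi> s, \<pi> t) (x - y) = G (\<pi> s, \<pi> t) x - G (\<pi> s, \<pi> t) y"
      by (simp add: G_def frag_extend_diff)
    then show ?case
      using diff pairs_closed(4) jet_cong_diff by (simp only: to_jet_diff right_diff_distrib) blast
  qed
  show ?thesis
    unfolding mult using assms(1)
  proof (induction x rule: pairs_induct)
    case zero
    show ?case by simp
  next
    case (tensor s t)
    show ?case using mult_tensor[OF assms(2)] by simp
  next
    case (diff x x')
    show ?case
      using diff pairs_closed(4) jet_cong_diff by (simp only: frag_extend_diff to_jet_diff left_diff_distrib) blast
  qed
qed

text \<open>The image contains the constants and \<open>d\<^sub>i = taylor x\<^sub>i - x\<^sub>i\<close>, and it is closed under sums and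
  products modulo \<open>jet_relations\<close>.\<close>

lemma to_jet_surj: "\<exists>x\<in>pairs. to_jet x \<doteq> f"
proof (induction f rule: mpoly_induct)
  case (const s)
  show ?case
    using pair_jet[of s 1] pairs_closed(2)[of s 1]
    by (intro bexI[of _ "frag_of (\<pi> s, \<pi> 1)"]) (simp_all add: taylor_simps)
next
  case (var i)
  have "to_jet (frag_of (\<pi> 1, \<pi> (var i)) - frag_of (\<pi> (var i), \<pi> 1)) \<doteq> const 1 * taylor (var i) - const (var i) * taylor 1"
    unfolding to_jet_diff to_jet_simps by (intro jet_cong_diff pair_jet)
  then show ?case
    by (intro bexI[OF _ pairs_closed(4)[OF pairs_closed(2) pairs_closed(2)]]) (simp add: taylor_simps taylor_var)
next
  case (add f g)
  then obtain x y where "x \<in> pairs" "to_jet x \<doteq> f" "y \<in> pairs" "to_jet y \<doteq> g" by blast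
  then show ?case
    using pairs_closed(3)[of x y] jet_cong_add[of "to_jet x" f "to_jet y" g] by (intro bexI[of _ "x + y"]) (simp_all add: to_jet_add)
next
  case (mult f g)
  then obtain x y where xy: "x \<in> pairs" "to_jet x \<doteq> f" "y \<in> pairs" "to_jet y \<doteq> g" by blast
  have "to_jet (x \<otimes>\<^bsub>pair_RR\<^esub> y) \<doteq> to_jet x * to_jet y" "x \<otimes>\<^bsub>pair_RR\<^esub> y \<in> pairs"
    using pair_RR_mult[OF xy(1,3)] by simp_all
  then show ?case using jet_cong_trans[OF _ jet_cong_mult[OF xy(2,4)]] by blast
qed

text \<open>The inverse of \<open>to_jet\<close>, as a map to the tensor product: the fibre over the class of \<open>f\<close> is a full
  coset of the tensor relations.\<close>

definition of_jet :: "('n, ('n, 'k) mpoly) mpoly \<Rightarrow> (('n, 'k) mpoly set \<times> ('n, 'k) mpoly set \<Rightarrow>\<^sub>0 int) set"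
  where "of_jet f = {x \<in> pairs. to_jet x \<doteq> f}"

lemma of_jet_nonempty: "of_jet f \<noteq> {}"
  using to_jet_surj[of f] by (auto simp: of_jet_def)

lemma of_jet_eq_iff: "of_jet f = of_jet g \<longleftrightarrow> f \<doteq> g"
proof
  assume "of_jet f = of_jet g"
  moreover obtain x where "x \<in> of_jet f" using of_jet_nonempty by blast
  ultimately have "to_jet x \<doteq> f" "to_jet x \<doteq> g" by (auto simp: of_jet_def)
  then show "f \<doteq> g" using jet_cong_sym jet_cong_trans by blast
next
  assume fg: "f \<doteq> g"
  have "to_jet x \<doteq> f \<longleftrightarrow> to_jet x \<doteq> g" for x using jet_cong_trans fg jet_cong_sym by blast
  then show "of_jet f = of_jet g" by (simp add: of_jet_def)
qed

lemma coset_eq_of_jet: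
  assumes x: "x \<in> pairs"
  shows "\<K> +>\<^bsub>pair_RR\<^esub> x = of_jet (to_jet x)"
proof -
  have "y \<in> \<K> +>\<^bsub>pair_RR\<^esub> x \<longleftrightarrow> y - x \<in> \<K>" for y
    by (auto simp: a_r_coset_def' pair_RR_simps intro: bexI[of _ "y - x"])
  also have "\<dots> y \<longleftrightarrow> y \<in> of_jet (to_jet x)" for y
  proof (cases "y \<in> pairs")
    case True
    then show ?thesis
      using to_jet_in_jet_relations_iff[OF pairs_closed(4)[OF True x]] by (simp add: of_jet_def jet_cong_def to_jet_diff)
  next
    case False
    then have "y - x \<notin> \<K>" using \<K>_closed(3)[of "y - x"] pairs_closed(3)[OF _ x, of "y - x"] by auto
    then show ?thesis using False by (simp add: of_jet_def)
  qed
  finally show ?thesis by blast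
qed

abbreviation T where "T \<equiv> tensor_ring KK R R"

lemma tensor_eq_of_jet: "tensor KK R R (\<pi> s) (\<pi> t) = of_jet (const s * taylor t)"
  using coset_eq_of_jet[OF pairs_closed(2)] of_jet_eq_iff pair_jet by (simp add: tensor_def)

text \<open>The sum of two fibres is a fibre because \<open>to_jet\<close> is additive. Their product is a union of cosets, one for
  each choice of elements, and all of these agree because \<open>to_jet\<close> is multiplicative up to
  \<open>jet_relations\<close>.\<close>

lemma tensor_ring_presentation: "ring_presentation of_jet T"
proof -
  have carrier: "carrier T = range of_jet"
  proof -
    have "carrier T = (\<lambda>x. of_jet (to_jet x)) ` pairs"
      by (auto simp: tensor_ring_def FactRing_def A_RCOSETS_def' pair_RR_simps(1) coset_eq_of_jet)
    also have "\<dots> = range of_jet"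
    proof -
      have "\<exists>x\<in>pairs. of_jet f = of_jet (to_jet x)" for f
        using to_jet_surj[of f] of_jet_eq_iff jet_cong_sym by blast
      then show ?thesis by blast
    qed
    finally show ?thesis .
  qed
  have one: "\<one>\<^bsub>T\<^esub> = of_jet 1"
    using tensor_eq_of_jet[of 1 1]
    by (simp add: tensor_ring_def FactRing_def pair_RR_simps(3) tensor_def taylor_simps)
  have zero: "\<zero>\<^bsub>T\<^esub> = of_jet 0"
  proof -
    have "\<K> = of_jet 0"
      using \<K>_closed(3) to_jet_in_jet_relations_iff by (auto simp: of_jet_def jet_cong_def)
    then show ?thesis by (simp add: tensor_ring_def FactRing_def)
  qed
  have add: "of_jet f \<oplus>\<^bsub>T\<^esub> of_jet g = of_jet (f + g)" for f g
  proof -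
    have "of_jet f \<oplus>\<^bsub>T\<^esub> of_jet g = {x + y | x y. x \<in> of_jet f \<and> y \<in> of_jet g}"
      by (auto simp: tensor_ring_def FactRing_def set_add_def' pair_RR_simps(2))
    also have "\<dots> = of_jet (f + g)"
    proof (rule Set.set_eqI, rule iffI)
      fix z assume "z \<in> {x + y | x y. x \<in> of_jet f \<and> y \<in> of_jet g}"
      then obtain x y where "z = x + y" "x \<in> of_jet f" "y \<in> of_jet g" by blast
      then show "z \<in> of_jet (f + g)"
        using pairs_closed(3)[of x y] jet_cong_add[of "to_jet x" f "to_jet y" g] by (simp add: of_jet_def to_jet_add)
    next
      fix z assume z: "z \<in> of_jet (f + g)"
      obtain x where x: "x \<in> of_jet f" using of_jet_nonempty by blast
      have "z - x \<in> of_jet g"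
        using z x pairs_closed(4)[of z x] jet_cong_diff[of "to_jet z" "f + g" "to_jet x" f] by (simp add: of_jet_def to_jet_diff)
      moreover have "z = x + (z - x)" by simp
      ultimately show "z \<in> {x + y | x y. x \<in> of_jet f \<and> y \<in> of_jet g}" using x by blast
    qed
    finally show ?thesis .
  qed
  have mult: "of_jet f \<otimes>\<^bsub>T\<^esub> of_jet g = of_jet (f * g)" for f g
  proof -
    have "\<K> +>\<^bsub>pair_RR\<^esub> (x \<otimes>\<^bsub>pair_RR\<^esub> y) = of_jet (f * g)" if "x \<in> of_jet f" "y \<in> of_jet g" for x y
    proof -
      have xy: "x \<in> pairs" "y \<in> pairs" "to_jet x \<doteq> f" "to_jet y \<doteq> g" using that by (simp_all add: of_jet_def)
      have "to_jet (x \<otimes>\<^bsub>pair_RR\<^esub> y) \<doteq> f * g"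
        using pair_RR_mult[OF xy(1,2)] jet_cong_mult[OF xy(3,4)] jet_cong_trans by blast
      then show ?thesis
        using pair_RR_mult[OF xy(1,2)] coset_eq_of_jet of_jet_eq_iff by simp
    qed
    then have "(\<Union>x\<in>of_jet f. \<Union>y\<in>of_jet g. \<K> +>\<^bsub>pair_RR\<^esub> (x \<otimes>\<^bsub>pair_RR\<^esub> y)) = (\<Union>x\<in>of_jet f. \<Union>y\<in>of_jet g. of_jet (f * g))"
      by (intro SUP_cong refl)
    also have "\<dots> = of_jet (f * g)" by (simp only: UN_constant of_jet_nonempty if_False)
    finally show ?thesis by (simp add: tensor_ring_def FactRing_def rcoset_mult_def)
  qed
  show ?thesis by (simp add: ring_presentation_def carrier one zero add mult)
qed

lemmas T_simps = ring_presentationD[OF tensor_ring_presentation]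

section \<open>Powers of the diagonal ideal and the jet module\<close>

interpretation T: cring T
  by (rule ring_presentation_cring[OF tensor_ring_presentation])

lemma ideal_image_of_jet:
  assumes "0 \<in> E" "\<And>f g. f \<in> E \<Longrightarrow> g \<in> E \<Longrightarrow> f + g \<in> E" "\<And>f g. f \<in> E \<Longrightarrow> g * f \<in> E"
  shows "ideal (of_jet ` E) T"
proof (rule idealI[OF T.ring_axioms])
  have minus: "- f \<in> E" if "f \<in> E" for f using assms(3)[OF that, of "- 1"] by simp
  show "subgroup (of_jet ` E) (add_monoid T)"
  proof (rule T.add.subgroupI)
    show "of_jet ` E \<noteq> {}" using assms(1) by blast
    fix a assume "a \<in> of_jet ` E"
    then obtain f where f: "f \<in> E" "a = of_jet f" by blast
    have "\<ominus>\<^bsub>T\<^esub> a = of_jet (- f)"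
      using f by (intro T.minus_equality) (simp_all add: T_simps)
    then show "\<ominus>\<^bsub>T\<^esub> a \<in> of_jet ` E" using minus f by blast
  qed (use T_simps assms in auto)
  show "x \<otimes>\<^bsub>T\<^esub> a \<in> of_jet ` E" "a \<otimes>\<^bsub>T\<^esub> x \<in> of_jet ` E" if "a \<in> of_jet ` E" "x \<in> carrier T" for a x
  proof -
    from that obtain f g where "f \<in> E" "a = of_jet f" "x = of_jet g" by (auto simp: T_simps(1))
    then show "x \<otimes>\<^bsub>T\<^esub> a \<in> of_jet ` E" "a \<otimes>\<^bsub>T\<^esub> x \<in> of_jet ` E"
      using assms(3)[of f g] by (simp_all add: T_simps mult.commute)
  qed
qed

lemma ideal_of_jet_order_ge: "ideal (of_jet ` order_ge k) T"
proof (rule ideal_image_of_jet)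
  show "g * f \<in> order_ge k" if "f \<in> order_ge k" for f g
    using order_ge_mult[of g 0 f k] that by simp
qed (auto intro: order_ge_closed)

text \<open>The generators \<open>1 \<otimes> a - a \<otimes> 1\<close> are \<open>a(x + d) - a(x)\<close>, which has no constant term in \<open>d\<close>; conversely
  the ideal of the polynomials without constant term is generated by the \<open>d\<^sub>i\<close>, which arise from
  \<open>a = x\<^sub>i\<close>.\<close>

lemma diagonal_ideal_eq: "diagonal_ideal KK R = of_jet ` order_ge 1"
proof -
  let ?G = "{tensor KK R R \<one>\<^bsub>R\<^esub> a \<ominus>\<^bsub>T\<^esub> tensor KK R R a \<one>\<^bsub>R\<^esub> | a. a \<in> carrier R}"
  have G: "?G = {of_jet (taylor s - const s) | s. True}"
  proof -
    have "tensor KK R R \<one>\<^bsub>R\<^esub> (\<pi> s) \<ominus>\<^bsub>T\<^esub> tensor KK R R (\<pi> s) \<one>\<^bsub>R\<^esub> = of_jet (taylor s - const s)" for s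
      by (simp add: R_simps tensor_eq_of_jet ring_presentation_minus[OF tensor_ring_presentation] taylor_simps)
    then have "?G = (\<lambda>s. of_jet (taylor s - const s)) ` UNIV"
      unfolding R_simps(1) by (auto simp: image_iff)
    then show ?thesis by blast
  qed
  have sub: "?G \<subseteq> of_jet ` order_ge 1"
    unfolding G by (auto simp: order_ge_def lookup_minus coef_taylor_0)
  have "of_jet ` order_ge 1 \<subseteq> I" if I: "ideal I T" "?G \<subseteq> I" for I
  proof
    interpret I: ideal I T by (rule I(1))
    have "of_jet f \<in> I" if "f \<in> order_ge (Suc 0)" for f
      using that
    proof (induction rule: order_ge_Suc_induct)
      case zero
      show ?case using I.zero_closed by (simp add: T_simps)
    next
      case (mult g i)
      have "of_jet (taylor (var i) - const (var i)) \<in> I" using I(2) unfolding G by blast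
      then have "of_jet (var i) \<in> I" by (simp add: taylor_var)
      then have "of_jet g \<otimes>\<^bsub>T\<^esub> of_jet (var i) \<in> I" using T_simps(6) by (intro I.I_l_closed)
      then show ?case by (simp add: T_simps)
    next
      case (add f g)
      then have "of_jet f \<oplus>\<^bsub>T\<^esub> of_jet g \<in> I" by (intro I.a_closed)
      then show ?case by (simp add: T_simps)
    qed
    then show "x \<in> I" if "x \<in> of_jet ` order_ge 1" for x using that by auto
  qed
  then show ?thesis
    unfolding diagonal_ideal_def genideal_def using sub ideal_of_jet_order_ge[of 1] by blast
qed

lemma diagonal_ideal_power: "diagonal_ideal KK R [^]\<^bsub>ideals_set T\<^esub> k = of_jet ` order_ge k"
proof (induction k)
  case 0
  show ?case by (simp add: ideals_set_def T_simps)
next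
  case (Suc k)
  have "of_jet ` order_ge k \<cdot>\<^bsub>T\<^esub> of_jet ` order_ge 1 = of_jet ` order_ge (Suc k)"
  proof
    show "of_jet ` order_ge k \<cdot>\<^bsub>T\<^esub> of_jet ` order_ge 1 \<subseteq> of_jet ` order_ge (Suc k)"
    proof
      fix x assume "x \<in> of_jet ` order_ge k \<cdot>\<^bsub>T\<^esub> of_jet ` order_ge 1"
      then show "x \<in> of_jet ` order_ge (Suc k)"
      proof (induction rule: ideal_prod.induct)
        case (prod i j)
        then obtain f g where "f \<in> order_ge k" "i = of_jet f" "g \<in> order_ge 1" "j = of_jet g" by blast
        then show ?case using order_ge_mult[of f k g 1] by (simp add: T_simps)
      next
        case (sum s1 s2)
        then obtain f g where "f \<in> order_ge (Suc k)" "s1 = of_jet f" "g \<in> order_ge (Suc k)" "s2 = of_jet g" by blast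
        then show ?case using order_ge_closed(2)[of f "Suc k" g] by (simp add: T_simps)
      qed
    qed
    have "of_jet f \<in> of_jet ` order_ge k \<cdot>\<^bsub>T\<^esub> of_jet ` order_ge 1" if "f \<in> order_ge (Suc k)" for f
      using that
    proof (induction rule: order_ge_Suc_induct)
      case zero
      have "of_jet 0 \<otimes>\<^bsub>T\<^esub> of_jet 0 \<in> of_jet ` order_ge k \<cdot>\<^bsub>T\<^esub> of_jet ` order_ge 1"
        by (intro ideal_prod.prod imageI order_ge_closed(1))
      then show ?case by (simp add: T_simps)
    next
      case (mult g i)
      then have "of_jet g \<otimes>\<^bsub>T\<^esub> of_jet (var i) \<in> of_jet ` order_ge k \<cdot>\<^bsub>T\<^esub> of_jet ` order_ge 1"
        by (intro ideal_prod.prod imageI var_order_ge)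
      then show ?case by (simp add: T_simps)
    next
      case (add f g)
      from ideal_prod.sum[OF add] show ?case by (simp add: T_simps)
    qed
    then show "of_jet ` order_ge (Suc k) \<subseteq> of_jet ` order_ge k \<cdot>\<^bsub>T\<^esub> of_jet ` order_ge 1" by blast
  qed
  then show ?case using Suc by (simp add: diagonal_ideal_eq ideals_set_def)
qed

text \<open>Under \<open>of_jet\<close>, multiplication by \<open>s \<otimes> 1\<close> is multiplication by the constant \<open>s\<close>, that is, scaling of all
  coefficients. So the presentation of the tensor square restricts to the diagonal ideal, and
  passing to the quotient by its power adds the polynomials of order greater than \<open>m\<close> to the kernel.\<close>

lemma jet_module_presentation:
  obtains \<gamma> where "module_presentation \<pi> R \<gamma> (order_ge 1) (jet_module KK R m)"
    "\<And>h. h \<in> order_ge 1 \<Longrightarrow> \<gamma> h = \<zero>\<^bsub>jet_module KK R m\<^esub> \<longleftrightarrow> (\<exists>z\<in>order_ge (m + 1). h \<doteq> z)"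
proof -
  define M where "M = \<lparr>carrier = diagonal_ideal KK R, monoid.mult = monoid.mult T, one = one T,
     ring.zero = ring.zero T, add = add T,
     module.smult = (\<lambda>r x. tensor KK R R r \<one>\<^bsub>R\<^esub> \<otimes>\<^bsub>T\<^esub> x)\<rparr>"
  define L where "L = of_jet ` order_ge (m + 1)"
  have jet: "jet_module KK R m = quot_module M L"
    by (simp add: jet_module_def M_def L_def Let_def diagonal_ideal_power[of "m + 1", simplified])
  have pres: "module_presentation \<pi> R of_jet (order_ge 1) M"
    unfolding module_presentation_def
  proof (intro conjI ballI allI)
    show "ring_presentation \<pi> R" by (rule hypersurface_presentation)
    show "carrier M = of_jet ` order_ge 1" by (simp add: M_def diagonal_ideal_eq)
    show "of_jet (mscale s f) = \<pi> s \<odot>\<^bsub>M\<^esub> of_jet f" for s f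
      by (simp add: M_def R_simps tensor_eq_of_jet T_simps taylor_simps) (simp add: mscale_def)
  qed (auto simp: M_def T_simps intro: order_ge_closed)
  have sub: "order_ge (m + 1) \<subseteq> order_ge 1" by (rule order_ge_mono) simp
  note P = module_presentationD[OF pres]
  have L: "L \<subseteq> carrier M" "\<zero>\<^bsub>M\<^esub> \<in> L" "\<And>x y. x \<in> L \<Longrightarrow> y \<in> L \<Longrightarrow> x \<oplus>\<^bsub>M\<^esub> y \<in> L"
      "\<And>s x. x \<in> L \<Longrightarrow> \<pi> s \<odot>\<^bsub>M\<^esub> x \<in> L"
  proof -
    show "L \<subseteq> carrier M" using sub by (auto simp: L_def P(5))
    show "\<zero>\<^bsub>M\<^esub> \<in> L" using order_ge_closed(1) by (auto simp: L_def P(6))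
    fix x assume "x \<in> L"
    then obtain f where f: "f \<in> order_ge (m + 1)" "x = of_jet f" by (auto simp: L_def)
    then show "\<pi> s \<odot>\<^bsub>M\<^esub> x \<in> L" for s
      using P(8)[of f s] sub order_ge_closed(3)[of f "m + 1" s] by (auto simp: L_def)
    fix y assume "y \<in> L"
    then obtain g where "g \<in> order_ge (m + 1)" "y = of_jet g" by (auto simp: L_def)
    then show "x \<oplus>\<^bsub>M\<^esub> y \<in> L"
      using f P(7)[of f g] sub order_ge_closed(2)[of f "m + 1" g] by (auto simp: L_def)
  qed
  show ?thesis
  proof (rule that)
    show "module_presentation \<pi> R (\<lambda>f. L +>\<^bsub>M\<^esub> of_jet f) (order_ge 1) (jet_module KK R m)"
      unfolding jet by (rule quotient_presentation(1)[OF pres L])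
    fix h :: "('n, ('n, 'k) mpoly) mpoly" assume h: "h \<in> order_ge 1"
    have "L +>\<^bsub>M\<^esub> of_jet h = \<zero>\<^bsub>jet_module KK R m\<^esub> \<longleftrightarrow> of_jet h \<in> L"
      unfolding jet by (rule quotient_presentation(2)[OF pres L]) (use h in auto)
    also have "\<dots> \<longleftrightarrow> (\<exists>z\<in>order_ge (m + 1). h \<doteq> z)"
      by (auto simp: L_def image_iff of_jet_eq_iff)
    finally show "L +>\<^bsub>M\<^esub> of_jet h = \<zero>\<^bsub>jet_module KK R m\<^esub> \<longleftrightarrow> (\<exists>z\<in>order_ge (m + 1). h \<doteq> z)" .
  qed
qed

definition jet_matrix :: "('n \<Rightarrow>\<^sub>0 nat) \<Rightarrow> ('n \<Rightarrow>\<^sub>0 nat) \<Rightarrow> ('n, 'k) mpoly"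
  where "jet_matrix \<alpha> \<beta> = (if mle \<beta> \<alpha> then coef (taylor Q) (\<alpha> - \<beta>) else 0)"

text \<open>The coefficient of \<open>d\<^sup>\<alpha>\<close> in \<open>Q(x + d) w\<close> involves all \<open>\<beta> \<le> \<alpha>\<close>, whereas the right-hand side
  stops at \<open>|\<beta>| = m - 1\<close>. The only \<open>\<beta>\<close> that can be missing is \<open>\<alpha>\<close> itself, and its matrix entry
  is the constant term \<open>Q\<close> of \<open>Q(x + d)\<close>, which vanishes in \<open>R\<close>.\<close>

lemma coef_taylor_mult:
  assumes "\<alpha> \<in> jet_exponents m"
  shows "\<pi> (coef (taylor Q * w) \<alpha>) = \<pi> (\<Sum>\<beta>\<in>jet_indices m. jet_matrix \<alpha> \<beta> * coef w \<beta>)"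
proof -
  let ?t = "\<lambda>\<beta>. coef (taylor Q) (\<alpha> - \<beta>) * coef w \<beta>"
  let ?B = "jet_indices m \<inter> {\<beta>. mle \<beta> \<alpha>}"
  have "(\<Sum>\<beta>\<in>jet_indices m. jet_matrix \<alpha> \<beta> * coef w \<beta>)
      = (\<Sum>\<beta>\<in>jet_indices m. if mle \<beta> \<alpha> then ?t \<beta> else 0)"
    by (rule sum.cong) (auto simp: jet_matrix_def)
  also have "\<dots> = sum ?t ?B"
    by (subst sum.inter_restrict[OF finite_jet_indices]) simp
  finally have rhs: "(\<Sum>\<beta>\<in>jet_indices m. jet_matrix \<alpha> \<beta> * coef w \<beta>) = sum ?t ?B" .
  have "coef (taylor Q * w) \<alpha> - sum ?t ?B = sum ?t ({\<beta>. mle \<beta> \<alpha>} - ?B)"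
    unfolding coef_mult by (subst sum_diff) (auto intro: finite_mle)
  moreover have "{\<beta>. mle \<beta> \<alpha>} - ?B \<subseteq> {\<alpha>}"
  proof
    fix \<beta> assume \<beta>: "\<beta> \<in> {\<beta>. mle \<beta> \<alpha>} - ?B"
    then have "m - 1 < msize \<beta>" "mle \<beta> \<alpha>" by (auto simp: jet_indices_def)
    then show "\<beta> \<in> {\<alpha>}" using mle_msize_less[of \<beta> \<alpha>] assms by (force simp: jet_exponents_def)
  qed
  then have "Q dvd sum ?t ({\<beta>. mle \<beta> \<alpha>} - ?B)"
    by (intro dvd_sum) (auto simp: coef_taylor_0)
  ultimately show ?thesis unfolding rhs by (simp only: residue_class_eq_iff)
qed

text \<open>Membership of \<open>h\<close> in the ideal \<open>(Q(x), Q(x + d)) + (d)\<^sup>m\<^sup>+\<^sup>1\<close>, read off coefficient by coefficient. In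
  degree \<open>0\<close> there is no condition, because \<open>h\<close> has no constant term and that of \<open>Q(x + d) w\<close> is
  divisible by \<open>Q\<close>.\<close>

lemma jet_relation_iff:
  assumes h: "h \<in> order_ge 1"
  shows "(\<exists>z\<in>order_ge (m + 1). h \<doteq> z) \<longleftrightarrow>
    (\<exists>w. \<forall>\<alpha>\<in>jet_exponents m. \<pi> (coef h \<alpha>) = \<pi> (\<Sum>\<beta>\<in>jet_indices m. jet_matrix \<alpha> \<beta> * coef w \<beta>))"
proof
  assume "\<exists>z\<in>order_ge (m + 1). h \<doteq> z"
  then obtain z u w where z: "z \<in> order_ge (m + 1)" and "h - z = const Q * u + taylor Q * w"
    unfolding jet_cong_def jet_relations_def by blast
  then have h_eq: "h = mscale Q u + taylor Q * w + z" by (simp add: mscale_def algebra_simps)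
  have "\<pi> (coef h \<alpha>) = \<pi> (coef (taylor Q * w) \<alpha>)" if "\<alpha> \<in> jet_exponents m" for \<alpha>
  proof -
    have "coef z \<alpha> = 0" using z that by (simp add: order_ge_def jet_exponents_def)
    then have "coef h \<alpha> - coef (taylor Q * w) \<alpha> = Q * coef u \<alpha>"
      by (simp add: h_eq lookup_add)
    then show ?thesis by (simp add: residue_class_eq_iff)
  qed
  then show "\<exists>w. \<forall>\<alpha>\<in>jet_exponents m. \<pi> (coef h \<alpha>) = \<pi> (\<Sum>\<beta>\<in>jet_indices m. jet_matrix \<alpha> \<beta> * coef w \<beta>)"
    by (intro exI[of _ w]) (simp add: coef_taylor_mult)
next
  assume "\<exists>w. \<forall>\<alpha>\<in>jet_exponents m. \<pi> (coef h \<alpha>) = \<pi> (\<Sum>\<beta>\<in>jet_indices m. jet_matrix \<alpha> \<beta> * coef w \<beta>)"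
  then obtain w where w': "\<forall>\<alpha>\<in>jet_exponents m.
      \<pi> (coef h \<alpha>) = \<pi> (\<Sum>\<beta>\<in>jet_indices m. jet_matrix \<alpha> \<beta> * coef w \<beta>)" by blast
  have w: "\<pi> (coef h \<alpha>) = \<pi> (coef (taylor Q * w) \<alpha>)" if "\<alpha> \<in> jet_exponents m" for \<alpha>
    using w' that coef_taylor_mult[OF that] by simp
  have dvd: "Q dvd coef h \<alpha> - coef (taylor Q * w) \<alpha>" if "msize \<alpha> \<le> m" for \<alpha>
  proof (cases "\<alpha> = 0")
    case True
    then show ?thesis using h by (simp add: order_ge_def coef_mult_0 coef_taylor_0)
  next
    case False
    then have "1 \<le> msize \<alpha>" using msize_eq_0_iff[of \<alpha>] by linarith
    then show ?thesis using w[of \<alpha>] that by (simp add: jet_exponents_def residue_class_eq_iff)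
  qed
  then have "\<forall>\<alpha>. \<exists>v. msize \<alpha> \<le> m \<longrightarrow> coef h \<alpha> - coef (taylor Q * w) \<alpha> = Q * v" by (auto simp: dvd_def)
  then obtain v where v: "\<And>\<alpha>. msize \<alpha> \<le> m \<Longrightarrow> coef h \<alpha> - coef (taylor Q * w) \<alpha> = Q * v \<alpha>" by metis
  \<comment> \<open>Subtracting the multiple of \<open>Q\<close> with the quotients as coefficients removes all terms of degree at
    most \<open>m\<close>.\<close>
  define u where "u = (\<Sum>\<alpha> | msize \<alpha> \<le> m. Poly_Mapping.single \<alpha> (v \<alpha>))"
  define z where "z = h - (const Q * u + taylor Q * w)"
  have z': "z = h - (mscale Q u + taylor Q * w)" by (simp add: z_def mscale_def)
  have "coef z \<alpha> = 0" if "msize \<alpha> < m + 1" for \<alpha>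
    using v[of \<alpha>] that
    by (simp add: z' u_def lookup_minus lookup_add coef_sum_singles[OF finite_msize_le] algebra_simps)
  then have "z \<in> order_ge (m + 1)" by (simp add: order_ge_def)
  moreover have "h \<doteq> z" unfolding jet_cong_def jet_relations_def z_def by auto
  ultimately show "\<exists>z\<in>order_ge (m + 1). h \<doteq> z" by blast
qed

lemma is_transpose_jet_moduleI:
  assumes N: "module_presentation \<pi> R \<nu> UNIV N"
    "\<And>f. \<nu> f = \<zero>\<^bsub>N\<^esub> \<longleftrightarrow> (\<exists>u. \<forall>\<beta>\<in>jet_indices m.
       \<pi> (coef f \<beta>) = \<pi> (\<Sum>\<alpha>\<in>jet_exponents m. coef u \<alpha> * jet_matrix \<alpha> \<beta>))"
  shows "is_transpose R (jet_module KK R m) N"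
proof -
  obtain \<gamma> where \<gamma>: "module_presentation \<pi> R \<gamma> (order_ge 1) (jet_module KK R m)"
    "\<And>h. h \<in> order_ge 1 \<Longrightarrow> \<gamma> h = \<zero>\<^bsub>jet_module KK R m\<^esub> \<longleftrightarrow> (\<exists>z\<in>order_ge (m + 1). h \<doteq> z)"
    using jet_module_presentation[of m] by blast
  show ?thesis
  proof (rule is_transposeI[OF finite_jet_exponents finite_jet_indices \<gamma>(1) _ _ N])
    show "Poly_Mapping.single \<alpha> s \<in> order_ge 1" if "\<alpha> \<in> jet_exponents m" for \<alpha> and s :: "('n, 'k) mpoly"
      using that by (auto simp: order_ge_def jet_exponents_def lookup_single when_def)
    show "\<gamma> h = \<zero>\<^bsub>jet_module KK R m\<^esub> \<longleftrightarrow> (\<exists>w. \<forall>\<alpha>\<in>jet_exponents m.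
        \<pi> (coef h \<alpha>) = \<pi> (\<Sum>\<beta>\<in>jet_indices m. jet_matrix \<alpha> \<beta> * coef w \<beta>))" if "h \<in> order_ge 1" for h
      using \<gamma>(2)[OF that] jet_relation_iff[OF that] by simp
  qed
qed

end

section \<open>The module defined by the derivatives of Q\<close>

lemma poly_algebra_presentation: "ring_presentation (\<lambda>s. s) poly_algebra"
  by (simp add: ring_presentation_def)

text \<open>The submodule \<open>J\<^sub>m\<close> consists of the combinations of the rows of the jet matrix, by Taylor's formula for its
  entries. Adding the multiples of \<open>Q\<close> replaces equality of coefficients by equality in \<open>R\<close>.\<close>

lemma jet_quotient_presentation:
  fixes Q :: "('n::finite, 'k::field_char_0) mpoly"
  obtains \<nu> where "module_presentation (residue_class Q) (hypersurface_algebra Q) \<nu> UNIV (jet_quotient m Q)"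
    "\<And>f. \<nu> f = \<zero>\<^bsub>jet_quotient m Q\<^esub> \<longleftrightarrow> (\<exists>u. \<forall>\<beta>\<in>jet_indices m. residue_class Q (coef f \<beta>) =
       residue_class Q (\<Sum>\<alpha>\<in>jet_exponents m. coef u \<alpha> * hypersurface.jet_matrix Q \<alpha> \<beta>))"
proof -
  let ?S = "poly_algebra :: ('k, ('n, 'k) mpoly) module"
  let ?c = "hypersurface.jet_matrix Q"
  define F where "F = free_module ?S (jet_indices m :: ('n \<Rightarrow>\<^sub>0 nat) set)"
  define e where "e f = (\<lambda>\<beta>\<in>jet_indices m. coef f \<beta>)" for f :: "('n, ('n, 'k) mpoly) mpoly"
  \<comment> \<open>The combination of the rows of the jet matrix with the coefficients of \<open>u\<close>.\<close>
  define C where "C u = (\<Sum>\<beta>\<in>jet_indices m. Poly_Mapping.single \<beta> (\<Sum>\<alpha>\<in>jet_exponents m. coef u \<alpha> * ?c \<alpha> \<beta>))"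
    for u :: "('n, ('n, 'k) mpoly) mpoly"
  have presF: "module_presentation (\<lambda>s. s) ?S e UNIV F"
    unfolding F_def e_def
    by (rule free_module_presentation[OF poly_algebra_presentation finite_jet_indices, where a = "\<lambda>\<beta>. \<beta>"]) auto
  note PF = module_presentationD[OF presF]
  interpret F: module ?S F by (rule module_presentation_module[OF presF])
  have e_eq: "e f = e g \<longleftrightarrow> (\<forall>\<beta>\<in>jet_indices m. coef f \<beta> = coef g \<beta>)" for f g
    by (auto simp: e_def fun_eq_iff restrict_def)
  have coef_C: "coef (C u) \<beta> = (\<Sum>\<alpha>\<in>jet_exponents m. coef u \<alpha> * ?c \<alpha> \<beta>)" if "\<beta> \<in> jet_indices m" for u \<beta>
    using that by (simp add: C_def coef_sum_singles finite_jet_indices)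
  have eC_add: "e (C (u + v)) = e (C u) \<oplus>\<^bsub>F\<^esub> e (C v)" for u v
    by (simp add: PF(7) e_eq lookup_add coef_C sum.distrib algebra_simps)
  have eC_scale: "e (C (mscale s u)) = s \<odot>\<^bsub>F\<^esub> e (C u)" for s u
    by (simp add: PF(8) e_eq coef_C sum_distrib_left algebra_simps)
  have eC_0: "e (C 0) = \<zero>\<^bsub>F\<^esub>" by (simp add: PF(6) e_eq coef_C)
  have gen: "jet_generator m Q \<alpha> = e (C (Poly_Mapping.single \<alpha> 1))" if "\<alpha> \<in> jet_exponents m" for \<alpha>
  proof -
    have "(\<Sum>\<alpha>'\<in>jet_exponents m. coef (Poly_Mapping.single \<alpha> 1) \<alpha>' * ?c \<alpha>' \<beta>)
        = (\<Sum>\<alpha>'\<in>jet_exponents m. if \<alpha>' = \<alpha> then ?c \<alpha>' \<beta> else 0)" for \<beta>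
      by (rule sum.cong) (auto simp: lookup_single when_def)
    then have "coef (C (Poly_Mapping.single \<alpha> 1)) \<beta> = ?c \<alpha> \<beta>" if "\<beta> \<in> jet_indices m" for \<beta>
      using that \<open>\<alpha> \<in> jet_exponents m\<close> by (simp add: coef_C finite_jet_exponents)
    then show ?thesis
      by (auto simp: jet_generator_def e_def fun_eq_iff restrict_def hypersurface.jet_matrix_def taylor_coefficient)
  qed
  have J: "jet_submodule m Q = range (\<lambda>u. e (C u))"
  proof -
    let ?G = "{jet_generator m Q \<alpha> | \<alpha>. 1 \<le> msize \<alpha> \<and> msize \<alpha> \<le> m}"
    have "submodule (range (\<lambda>u. e (C u))) ?S F"
    proof (rule F.submoduleI)
      show "range (\<lambda>u. e (C u)) \<subseteq> carrier F" using PF(5) by auto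
      show "\<zero>\<^bsub>F\<^esub> \<in> range (\<lambda>u. e (C u))" using eC_0 by (metis rangeI)
      fix a assume "a \<in> range (\<lambda>u. e (C u))"
      then obtain u where u: "a = e (C u)" by blast
      have "\<ominus>\<^bsub>F\<^esub> a = e (C (- u))"
        using eC_add[of "- u" u] eC_0 PF(5) by (intro F.M.minus_equality) (simp_all add: u)
      then show "\<ominus>\<^bsub>F\<^esub> a \<in> range (\<lambda>u. e (C u))" by blast
      show "s \<odot>\<^bsub>F\<^esub> a \<in> range (\<lambda>u. e (C u))" for s using eC_scale[of s u] u by (metis rangeI)
      fix b assume "b \<in> range (\<lambda>u. e (C u))"
      then obtain v where "b = e (C v)" by blast
      then show "a \<oplus>\<^bsub>F\<^esub> b \<in> range (\<lambda>u. e (C u))" using eC_add[of u v] u by (metis rangeI)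
    qed
    moreover have "?G \<subseteq> range (\<lambda>u. e (C u))" using gen by (auto simp: jet_exponents_def)
    moreover have "range (\<lambda>u. e (C u)) \<subseteq> N" if N: "submodule N ?S F" "?G \<subseteq> N" for N
    proof -
      interpret N: submodule N ?S F by (rule N(1))
      have "e (C u) \<in> N" for u
      proof (induction u rule: poly_mapping_additive_induct)
        case (single \<alpha> s)
        show ?case
        proof (cases "\<alpha> \<in> jet_exponents m")
          case True
          have "e (C (Poly_Mapping.single \<alpha> 1)) \<in> N" using N(2) gen[OF True] True by (auto simp: jet_exponents_def)
          then have "s \<odot>\<^bsub>F\<^esub> e (C (Poly_Mapping.single \<alpha> 1)) \<in> N" by simp
          moreover have "mscale s (Poly_Mapping.single \<alpha> 1) = Poly_Mapping.single \<alpha> s"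
            by (simp add: mscale_def mult_single)
          ultimately show ?thesis using eC_scale[of s "Poly_Mapping.single \<alpha> 1"] by simp
        next
          case False
          then have "(\<Sum>\<alpha>'\<in>jet_exponents m. coef (Poly_Mapping.single \<alpha> s) \<alpha>' * ?c \<alpha>' \<beta>) = 0" for \<beta>
            by (intro sum.neutral) (auto simp: lookup_single when_def)
          then have "e (C (Poly_Mapping.single \<alpha> s)) = \<zero>\<^bsub>F\<^esub>" by (simp add: PF(6) e_eq coef_C)
          then show ?thesis using N.one_closed by simp
        qed
      next
        case (add u v)
        then show ?case using N.m_closed[OF add] by (simp add: eC_add)
      qed
      then show ?thesis by blast
    qed
    ultimately show ?thesis
      unfolding jet_submodule_def generated_submodule_def F_def[symmetric] by blast
  qed
  define L where "L = jet_submodule m Q <+>\<^bsub>F\<^esub> {Q \<odot>\<^bsub>F\<^esub> v | v. v \<in> carrier F}"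
  have L: "L = {e (C u + mscale Q w) | u w. True}"
  proof -
    have "L = {e (C u) \<oplus>\<^bsub>F\<^esub> (Q \<odot>\<^bsub>F\<^esub> e w) | u w. True}"
      unfolding L_def J set_add_def' PF(5) by blast
    then show ?thesis by (simp add: PF(7,8))
  qed
  have L1: "L \<subseteq> carrier F" using L PF(5) by auto
  have L2: "\<zero>\<^bsub>F\<^esub> \<in> L"
  proof -
    have "\<zero>\<^bsub>F\<^esub> = e (C 0 + mscale Q 0)" using eC_0 by simp
    then show ?thesis unfolding L by blast
  qed
  have L3: "x \<oplus>\<^bsub>F\<^esub> y \<in> L" if xy: "x \<in> L" "y \<in> L" for x y
  proof -
    obtain u w u' w' where uw: "x = e (C u + mscale Q w)" "y = e (C u' + mscale Q w')" using xy unfolding L by blast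
    have "x \<oplus>\<^bsub>F\<^esub> y = e (C (u + u') + mscale Q (w + w'))"
      by (simp add: uw PF(7) e_eq coef_C lookup_add algebra_simps sum.distrib)
    then show ?thesis unfolding L by blast
  qed
  have L4: "s \<odot>\<^bsub>F\<^esub> x \<in> L" if x: "x \<in> L" for s x
  proof -
    obtain u w where uw: "x = e (C u + mscale Q w)" using x unfolding L by blast
    have "s \<odot>\<^bsub>F\<^esub> x = e (C (mscale s u) + mscale Q (mscale s w))"
      by (simp add: uw PF(8) e_eq coef_C lookup_add algebra_simps sum_distrib_left)
    then show ?thesis unfolding L by blast
  qed
  define \<nu> where "\<nu> f = L +>\<^bsub>F\<^esub> e f" for f
  have pres: "module_presentation (\<lambda>s. s) ?S \<nu> UNIV (quot_module F L)"
    unfolding \<nu>_def by (rule quotient_presentation(1)[OF presF L1 L2 L3 L4])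
  have ker: "\<nu> f = \<zero>\<^bsub>quot_module F L\<^esub> \<longleftrightarrow> e f \<in> L" for f
    unfolding \<nu>_def by (rule quotient_presentation(2)[OF presF L1 L2 L3 L4]) auto
  have jet: "jet_quotient m Q = module_over_quotient (quot_module F L)"
    by (simp add: jet_quotient_def F_def L_def Let_def)
  note P = module_presentationD[OF pres]
  \<comment> \<open>All representatives of a residue class act in the same way, because \<open>L\<close> contains the multiples of
    \<open>Q\<close>.\<close>
  have \<nu>_cong: "\<nu> (mscale a f) = \<nu> (mscale s f)" if a: "a \<in> residue_class Q s" for a s f
  proof -
    obtain t where "a - s = Q * t" using a by (auto simp: residue_class_def dvd_def)
    then have "a = s + Q * t" by (simp add: algebra_simps)
    then have "mscale a f - mscale s f = mscale Q (mscale t f)" by simp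
    then have "e (mscale a f - mscale s f) = e (C 0 + mscale Q (mscale t f))" by (simp add: e_eq coef_C lookup_add)
    then have "e (mscale a f - mscale s f) \<in> L" unfolding L by blast
    then show ?thesis using module_presentation_eq_iff[OF pres] ker by blast
  qed
  have "module_presentation (residue_class Q) (hypersurface_algebra Q) \<nu> UNIV (jet_quotient m Q)"
    unfolding module_presentation_def
  proof (intro conjI ballI allI)
    show "ring_presentation (residue_class Q) (hypersurface_algebra Q)" by (rule hypersurface_presentation)
    show "carrier (jet_quotient m Q) = range \<nu>" by (simp add: jet module_over_quotient_def P(5))
    show "\<zero>\<^bsub>jet_quotient m Q\<^esub> = \<nu> 0" by (simp add: jet module_over_quotient_def P(6))
    show "\<nu> (f + g) = \<nu> f \<oplus>\<^bsub>jet_quotient m Q\<^esub> \<nu> g" for f g by (simp add: jet module_over_quotient_def P(7))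
    show "\<nu> (mscale s f) = residue_class Q s \<odot>\<^bsub>jet_quotient m Q\<^esub> \<nu> f" for s f
    proof -
      have "(\<lambda>a. a \<odot>\<^bsub>quot_module F L\<^esub> \<nu> f) ` residue_class Q s = (\<lambda>a. \<nu> (mscale s f)) ` residue_class Q s"
        by (rule image_cong) (simp_all add: P(8) \<nu>_cong)
      also have "\<dots> = {\<nu> (mscale s f)}" using residue_class_nonempty[of Q s] by auto
      finally show ?thesis by (simp add: jet module_over_quotient_def)
    qed
  qed auto
  moreover have "\<nu> f = \<zero>\<^bsub>jet_quotient m Q\<^esub> \<longleftrightarrow> (\<exists>u. \<forall>\<beta>\<in>jet_indices m. residue_class Q (coef f \<beta>) =
       residue_class Q (\<Sum>\<alpha>\<in>jet_exponents m. coef u \<alpha> * ?c \<alpha> \<beta>))" for f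
  proof -
    have "\<nu> f = \<zero>\<^bsub>jet_quotient m Q\<^esub> \<longleftrightarrow> e f \<in> L"
      using ker[of f] by (simp add: jet module_over_quotient_def)
    also have "\<dots> \<longleftrightarrow> (\<exists>u w. \<forall>\<beta>\<in>jet_indices m. coef f \<beta> = coef (C u) \<beta> + Q * coef w \<beta>)"
      by (simp add: L e_eq lookup_add)
    also have "\<dots> \<longleftrightarrow> (\<exists>u. \<forall>\<beta>\<in>jet_indices m. Q dvd coef f \<beta> - coef (C u) \<beta>)"
    proof (intro iffI; elim exE)
      fix u w assume "\<forall>\<beta>\<in>jet_indices m. coef f \<beta> = coef (C u) \<beta> + Q * coef w \<beta>"
      then show "\<exists>u. \<forall>\<beta>\<in>jet_indices m. Q dvd coef f \<beta> - coef (C u) \<beta>" by (intro exI[of _ u]) simp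
    next
      fix u assume "\<forall>\<beta>\<in>jet_indices m. Q dvd coef f \<beta> - coef (C u) \<beta>"
      then have "\<forall>\<beta>\<in>jet_indices m. \<exists>w. coef f \<beta> - coef (C u) \<beta> = Q * w" by (simp add: dvd_def)
      then obtain w where w: "\<forall>\<beta>\<in>jet_indices m. coef f \<beta> - coef (C u) \<beta> = Q * w \<beta>" by metis
      let ?w = "\<Sum>\<beta>\<in>jet_indices m. Poly_Mapping.single \<beta> (w \<beta>)"
      have "\<forall>\<beta>\<in>jet_indices m. coef f \<beta> = coef (C u) \<beta> + Q * coef ?w \<beta>"
        using w by (simp add: coef_sum_singles finite_jet_indices algebra_simps)
      then show "\<exists>u w. \<forall>\<beta>\<in>jet_indices m. coef f \<beta> = coef (C u) \<beta> + Q * coef w \<beta>" by blast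
    qed
    finally show ?thesis by (simp add: residue_class_eq_iff coef_C)
  qed
  ultimately show ?thesis using that by blast
qed

text \<open>The columns of the jet matrix are the relations of the jet module, its rows those of the quotient by
  \<open>J\<^sub>m\<close>.\<close>

theorem is_transpose_jet_quotient:
  fixes Q :: "('n::finite, 'k::field_char_0) mpoly"
  shows "is_transpose (hypersurface_algebra Q)
           (jet_module (ring_of_type_algebra :: 'k ring) (hypersurface_algebra Q) m) (jet_quotient m Q)"
proof -
  obtain \<nu> where "module_presentation (residue_class Q) (hypersurface_algebra Q) \<nu> UNIV (jet_quotient m Q)"
    "\<And>f. \<nu> f = \<zero>\<^bsub>jet_quotient m Q\<^esub> \<longleftrightarrow> (\<exists>u. \<forall>\<beta>\<in>jet_indices m. residue_class Q (coef f \<beta>) =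
       residue_class Q (\<Sum>\<alpha>\<in>jet_exponents m. coef u \<alpha> * hypersurface.jet_matrix Q \<alpha> \<beta>))"
    using jet_quotient_presentation by blast
  then show ?thesis by (rule hypersurface.is_transpose_jet_moduleI)
qed

theorem theorem11p2:
  fixes \<A> :: "('k::field_char_0 ^ 'n::finite) set set"
    and p :: "('k ^ 'n) set \<Rightarrow> ('n, 'k) mpoly"
    and m :: nat
  assumes "generic_arrangement \<A>"
    and "\<And>H. H \<in> \<A> \<Longrightarrow> defining_form (p H) H"
    and "CARD('n) \<ge> 3" and "m \<ge> 1" and "CARD('n) + m - 1 < card \<A>"
  defines "Q \<equiv> \<Prod>H\<in>\<A>. p H"
  shows "is_transpose (hypersurface_algebra Q)
           (jet_module (ring_of_type_algebra :: 'k ring) (hypersurface_algebra Q) m)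
           (jet_quotient m Q)"
  by (rule is_transpose_jet_quotient)

end
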